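(* For every $B>0$ there is a constant $K>0$ depending only on $B$, and for every integer $d\ge1$ there is a function $\eta$ assigning a positive number $\eta(A)>0$ to each $A\subseteq[d]\times[d]$ for which $([d],A)$ is an acyclic directed graph, such that the following holds. Let $T\ge1$, let $w^*\in\mathbb{R}^d$ have pairwise distinct components, let $X_1,\dots,X_T\subseteq\mathbb{Z}^d$ be M-convex sets with $\max\{\langle w^*,x-x'\rangle : x,x'\in X_t\}\le B$ for all $t$, let $x_t\in X_t$ for $t\in[T]$ be arbitrary agent's actions, and let $$C=\Big|\Big\{t\in[T] : x_t\notin\arg\max_{x\in X_t}\langle w^*,x\rangle\Big\}\Big| .$$ Then every run of Algorithm 2 (described in the context, with perturbation size in round $t$ at most $\eta(A_t)$; the algorithm does not use $C$) satisfies $$R_T=\sum_{t=1}^T\langle w^*,x_t-\hat x_t\rangle\le K\,(C+1)\,d\log d .$$ That is, $R_T=O((C+1)d\log d)$.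
   Context: Notation: $[d]=\{1,\dots,d\}$; $x(i)$ is the $i$th component of $x\in\mathbb{R}^d$; $\mathbf{e}_i$ is the $i$th standard basis vector; $\langle\cdot,\cdot\rangle$ is the standard inner product. M-convex set: a non-empty set $X\subseteq\mathbb{Z}^d$ such that for any $x,y\in X$ and $i\in[d]$ with $x(i)>y(i)$ there is $j\in[d]$ with $x(j)<y(j)$, $x-\mathbf{e}_i+\mathbf{e}_j\in X$ and $y+\mathbf{e}_i-\mathbf{e}_j\in X$. Online inverse linear optimization with corrupted feedback: an agent has a hidden vector $w^*\in\mathbb{R}^d$. In each round $t=1,\dots,T$ the learner computes $\hat w_t\in\mathbb{R}^d$ from $(X_s,x_s)_{s<t}$, which suggests an action $\hat x_t\in\arg\max\{\langle\hat w_t,x\rangle : x\in X_t\}$; then the learner observes $X_t$ and the agent's action $x_t\in X_t$. Rounds with $x_t\notin\arg\max_{x\in X_t}\langle w^*,x\rangle$ are called corrupted, and $C$ is their number. The regret is $R_T=\sum_{t=1}^T\langle w^*,x_t-\hat x_t\rangle$, with the actual actions $x_t$. The sets $X_t$ and actions $x_t$ may be chosen adversarially (possibly adaptively). Algorithm 2: set $A_1=\emptyset$. For $t=1,\dots,T$: let $$P_t=\{w\in[0,1]^d : w(i)\ge w(j)\ \text{for all } (i,j)\in A_t\};$$ let $c_t$ be the center of gravity (centroid with respect to Lebesgue measure) of $P_t$; let $\hat w_t=c_t$ if the components of $c_t$ are distinct, and otherwise let $\hat w_t$ be any point of $P_t$ with pairwise distinct components and Euclidean distance at most $\eta(A_t)$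 from $c_t$ (an arbitrarily small tie-breaking perturbation within $P_t$). Then $\hat w_t(i)>\hat w_t(j)$ for all $(i,j)\in A_t$. Let $\hat x_t\in\arg\max\{\langle\hat w_t,x\rangle : x\in X_t\}$, observe $x_t$, and set $$A_{t+1}=A_t\cup\{(i,j): i\ne j,\ x_t-\mathbf{e}_i+\mathbf{e}_j\in X_t\}.$$ Restart: if the directed graph $([d],A_{t+1})$ (arc $i\to j$ for each $(i,j)\in A_{t+1}$) has a directed cycle, reset $A_{t+1}=\emptyset$. Thus $([d],A_t)$ is acyclic at the start of every round and $P_t$ has positive volume. *)

theory Defs
  imports "HOL-Analysis.Analysis"
begin

text \<open>
  The dimension is a natural number \<open>d\<close> rather than a type, because the constant in the regret bound
  has to be chosen before the dimension.  Vectors are extensional functions on \<open>{1..d}\<close>, so that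
  the real vectors are exactly the points of the product measure space used for Lebesgue measure.
\<close>

abbreviation rvec :: "nat \<Rightarrow> (nat \<Rightarrow> real) set" where
  "rvec d \<equiv> {1..d} \<rightarrow>\<^sub>E UNIV"

abbreviation zvec :: "nat \<Rightarrow> (nat \<Rightarrow> int) set" where
  "zvec d \<equiv> {1..d} \<rightarrow>\<^sub>E UNIV"

definition dotp :: "nat \<Rightarrow> (nat \<Rightarrow> real) \<Rightarrow> (nat \<Rightarrow> int) \<Rightarrow> real" where
  "dotp d w x = (\<Sum>i\<in>{1..d}. w i * real_of_int (x i))"

definition argmaxs :: "nat \<Rightarrow> (nat \<Rightarrow> real) \<Rightarrow> (nat \<Rightarrow> int) set \<Rightarrow> (nat \<Rightarrow> int) set" where
  "argmaxs d w X = {x. is_arg_max (dotp d w) (\<lambda>x. x \<in> X) x}"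

text \<open>\<open>exch d x i j\<close> is \<open>x - e\<^sub>i + e\<^sub>j\<close>.\<close>

definition exch :: "nat \<Rightarrow> (nat \<Rightarrow> int) \<Rightarrow> nat \<Rightarrow> nat \<Rightarrow> (nat \<Rightarrow> int)" where
  "exch d x i j = (\<lambda>k\<in>{1..d}. x k - of_bool (k = i) + of_bool (k = j))"

definition M_convex :: "nat \<Rightarrow> (nat \<Rightarrow> int) set \<Rightarrow> bool" where
  "M_convex d X \<longleftrightarrow> X \<noteq> {} \<and> X \<subseteq> zvec d \<and>
     (\<forall>x\<in>X. \<forall>y\<in>X. \<forall>i\<in>{1..d}. x i > y i \<longrightarrow>
        (\<exists>j\<in>{1..d}. x j < y j \<and> exch d x i j \<in> X \<and> exch d y j i \<in> X))"

definition lebesgue_d :: "nat \<Rightarrow> (nat \<Rightarrow> real) measure" where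
  "lebesgue_d d = Pi\<^sub>M {1..d} (\<lambda>_. lborel)"

definition centroid :: "nat \<Rightarrow> (nat \<Rightarrow> real) set \<Rightarrow> (nat \<Rightarrow> real)" where
  "centroid d P =
     (\<lambda>i\<in>{1..d}. (LINT w:P|lebesgue_d d. w i) / measure (lebesgue_d d) P)"

definition order_polytope :: "nat \<Rightarrow> (nat \<times> nat) set \<Rightarrow> (nat \<Rightarrow> real) set" where
  "order_polytope d A = {w \<in> {1..d} \<rightarrow>\<^sub>E {0..1}. \<forall>(i, j)\<in>A. w i \<ge> w j}"

text \<open>The admissible predictions of the learner when the current arc set is \<open>A\<close> and the
  tie-breaking perturbation may have size at most \<open>\<epsilon>\<close>.\<close>

definition predictions :: "nat \<Rightarrow> real \<Rightarrow> (nat \<times> nat) set \<Rightarrow> (nat \<Rightarrow> real) set" where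
  "predictions d \<epsilon> A =
     (let P = order_polytope d A; c = centroid d P in
      if inj_on c {1..d} then {c}
      else {w \<in> P. inj_on w {1..d} \<and> L2_set (\<lambda>i. w i - c i) {1..d} \<le> \<epsilon>})"

definition next_arcs ::
  "nat \<Rightarrow> (nat \<times> nat) set \<Rightarrow> (nat \<Rightarrow> int) set \<Rightarrow> (nat \<Rightarrow> int) \<Rightarrow> (nat \<times> nat) set" where
  "next_arcs d A X x =
     (let A' = A \<union> {(i, j). i \<in> {1..d} \<and> j \<in> {1..d} \<and> i \<noteq> j \<and> exch d x i j \<in> X}
      in if acyclic A' then A' else {})"

text \<open>A run of the algorithm on the feedback \<open>(X t, x t)\<close>, \<open>t = 1, \<dots>, T\<close>, with arc sets \<open>A t\<close>,
  predictions \<open>wh t\<close> and suggested actions \<open>xh t\<close>.\<close>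

definition alg_run ::
  "nat \<Rightarrow> ((nat \<times> nat) set \<Rightarrow> real) \<Rightarrow> nat \<Rightarrow>
   (nat \<Rightarrow> (nat \<Rightarrow> int) set) \<Rightarrow> (nat \<Rightarrow> nat \<Rightarrow> int) \<Rightarrow>
   (nat \<Rightarrow> (nat \<times> nat) set) \<Rightarrow> (nat \<Rightarrow> nat \<Rightarrow> real) \<Rightarrow> (nat \<Rightarrow> nat \<Rightarrow> int) \<Rightarrow> bool" where
  "alg_run d \<eta> T X x A wh xh \<longleftrightarrow>
     A 1 = {} \<and>
     (\<forall>t\<in>{1..T}.
        wh t \<in> predictions d (\<eta> (A t)) (A t) \<and>
        xh t \<in> argmaxs d (wh t) (X t) \<and>
        A (Suc t) = next_arcs d (A t) (X t) (x t))"

definition corruptions ::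
  "nat \<Rightarrow> nat \<Rightarrow> (nat \<Rightarrow> real) \<Rightarrow> (nat \<Rightarrow> (nat \<Rightarrow> int) set) \<Rightarrow> (nat \<Rightarrow> nat \<Rightarrow> int) \<Rightarrow> nat" where
  "corruptions d T w X x = card {t \<in> {1..T}. x t \<notin> argmaxs d w (X t)}"

definition regret ::
  "nat \<Rightarrow> nat \<Rightarrow> (nat \<Rightarrow> real) \<Rightarrow> (nat \<Rightarrow> nat \<Rightarrow> int) \<Rightarrow> (nat \<Rightarrow> nat \<Rightarrow> int) \<Rightarrow> real" where
  "regret d T w x xh = (\<Sum>t=1..T. dotp d w (\<lambda>i. x t i - xh t i))"

end

theory Submission
  imports Defs
begin

text \<open>
  If \<open>x t \<noteq> xh t\<close>, exchanging between the two actions yields an arc \<open>(i, j)\<close> of the new arc set with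
  \<open>wh t i < wh t j\<close>, so the new order polytope lies in a half-space that does not contain the
  centroid in its interior.  By a weak, dimension-free form of Gruenbaum's inequality, its volume drops
  by a constant factor.  The volume starts at \<open>1\<close> and stays at least \<open>d powr - d\<close> as long as the
  arc set is acyclic, so there are \<open>O(d ln d)\<close> mistakes between two restarts.  Arcs learned in
  uncorrupted rounds agree with the order of \<open>w\<close>, so each restart is paid for by a corruption.

  Gruenbaum's inequality comes from log-concavity of the tail \<open>s \<mapsto> vol {w \<in> P. s \<le> w j - w i}\<close>, for
  which the midpoint case of the Prekopa-Leindler inequality suffices.
\<close>

section \<open>The midpoint Prekopa-Leindler inequality\<close>

text \<open>The shrinkage factor must not depend on \<open>d\<close>. The functional form of
  Prekopa-Leindler achieves this: it passes through an induction over coordinates, and keeping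
  \<open>h\<close> as a separate measurable function avoids Minkowski sums, which need not be Borel.
  Midpoints are convenient because an order polytope is visibly closed under them. Any factor below
  1 gives the claimed order, so constants are chosen for easy estimates: 9/10 instead of Gruenbaum's
  1 - 1/e.

  Two demands on the prediction compete: strict exchanges need distinct coordinates, while the cut
  is governed by the centroid. A perturbation smaller than the strict gaps of the centroid meets
  both, and its size depends on \<open>d\<close> and the arc set alone.

  A restart empties the arc set, so different restarts are charged to different corruptions. The
  \<open>C + 1\<close> of the bound counts the phases that at most \<open>C\<close> restarts
  delimit.\<close>

lemma emeasure_lborel_atLeast: "emeasure lborel {a::real..} = top"
proof -
  have "of_nat n \<le> emeasure lborel {a..}" for n
  proof -
    have "of_nat n = emeasure lborel {a..a + real n}"
      by (simp add: ennreal_of_nat_eq_real_of_nat)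
    also have "\<dots> \<le> emeasure lborel {a..}" by (rule emeasure_mono) auto
    finally show ?thesis .
  qed
  then have "(SUP n. of_nat n) \<le> emeasure lborel {a..}" by (intro SUP_least)
  then show ?thesis by (simp add: ennreal_SUP_of_nat_eq_top top_unique)
qed

text \<open>Both sides measure the region below the graph of \<open>f\<close>, by Fubini. Above a
  point where \<open>f\<close> is infinite, this region is a half-line of infinite length.\<close>

lemma nn_integral_layer_cake:
  fixes f :: "'a \<Rightarrow> ennreal"
  assumes "sigma_finite_measure M" and [measurable]: "f \<in> borel_measurable M"
  shows "(\<integral>\<^sup>+x. f x \<partial>M) = (\<integral>\<^sup>+t\<in>{0..}. emeasure M {x \<in> space M. ennreal t < f x} \<partial>lborel)"
proof -
  interpret M: sigma_finite_measure M by fact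
  interpret pair_sigma_finite lborel M ..
  have layer: "(\<integral>\<^sup>+t. indicator {t. 0 \<le> t \<and> ennreal t < c} t \<partial>lborel) = c" for c
  proof (cases c)
    case (real r)
    then have "{t. 0 \<le> t \<and> ennreal t < c} = {0..<r}"
      by (auto simp: ennreal_less_iff)
    then show ?thesis using real by simp
  next
    case top
    then have "{t. 0 \<le> t \<and> ennreal t < c} = {0::real..}" by auto
    then show ?thesis using top by (simp add: emeasure_lborel_atLeast)
  qed
  have "(\<integral>\<^sup>+x. f x \<partial>M)
      = (\<integral>\<^sup>+x. (\<integral>\<^sup>+t. indicator {t. 0 \<le> t \<and> ennreal t < f x} t \<partial>lborel) \<partial>M)"
    by (simp only: layer)
  also have "\<dots> = (\<integral>\<^sup>+t. (\<integral>\<^sup>+x. indicator {t. 0 \<le> t \<and> ennreal t < f x} t \<partial>M) \<partial>lborel)"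
    by (rule Fubini') measurable
  also have "\<dots> = (\<integral>\<^sup>+t\<in>{0..}. emeasure M {x \<in> space M. ennreal t < f x} \<partial>lborel)"
  proof (rule nn_integral_cong)
    fix t :: real
    have "(\<integral>\<^sup>+x. indicator {t. 0 \<le> t \<and> ennreal t < f x} t \<partial>M)
        = (\<integral>\<^sup>+x. indicator {x \<in> space M. ennreal t < f x} x * indicator {0..} t \<partial>M)"
      by (rule nn_integral_cong) (auto simp: indicator_def)
    then show "(\<integral>\<^sup>+x. indicator {t. 0 \<le> t \<and> ennreal t < f x} t \<partial>M)
        = emeasure M {x \<in> space M. ennreal t < f x} * indicator {0..} t"
      by (simp add: nn_integral_multc)
  qed
  finally show ?thesis .
qed

section \<open>Brunn-Minkowski for midpoints on the real line\<close>

text \<open>Continuity of the measure from below. In the application the cut-off \<open>k\<close>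
  must belong to \<open>A\<close>, so that it can be paired with points of the other set, yet
  \<open>A\<close> may have no largest element. Points of \<open>A\<close> that are arbitrarily
  large, or arbitrarily close to a finite supremum, still exhaust \<open>A\<close> up to the
  supremum itself, a null set.\<close>

lemma emeasure_add_le_of_initial_segments:
  fixes A :: "real set"
  assumes A[measurable]: "A \<in> sets borel"
    and le: "\<And>k. k \<in> A \<Longrightarrow> emeasure lborel (A \<inter> {..k}) + b \<le> c"
    and ne: "A \<noteq> {}"
  shows "emeasure lborel A + b \<le> c"
proof -
  have seg: "emeasure lborel (A \<inter> {..q}) + b \<le> c" if "k \<in> A" "q \<le> k" for q k
    by (rule order_trans[OF _ le[OF that(1)]]) (use that in \<open>auto intro!: add_mono emeasure_mono\<close>)
  show ?thesis
  proof (cases "bdd_above A")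
    case False
    then have q: "\<exists>k\<in>A. q \<le> k" for q
      by (metis bdd_above.I linorder_le_cases)
    have "emeasure lborel A = emeasure lborel (\<Union>n::nat. A \<inter> {..real n})"
      by (rule arg_cong[where f="emeasure lborel"]) (auto simp: real_arch_simple)
    also have "\<dots> = (SUP n::nat. emeasure lborel (A \<inter> {..real n}))"
      by (rule SUP_emeasure_incseq[symmetric]) (auto simp: incseq_def)
    finally have "emeasure lborel A + b = (SUP n::nat. emeasure lborel (A \<inter> {..real n}) + b)"
      by (simp add: ennreal_SUP_add_left)
    also have "\<dots> \<le> c"
      using q seg by (intro SUP_least) blast
    finally show ?thesis .
  next
    case True
    define s where "s = Sup A"
    have "emeasure lborel A \<le> emeasure lborel ((A \<inter> {..<s}) \<union> {s})"
      using cSup_upper[OF _ True] by (intro emeasure_mono) (force simp: s_def less_le)+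
    also have "\<dots> \<le> emeasure lborel (A \<inter> {..<s}) + emeasure lborel {s}"
      by (rule emeasure_subadditive) auto
    also have "\<dots> = emeasure lborel (\<Union>n::nat. A \<inter> {..s - inverse (real (Suc n))})"
    proof -
      have "A \<inter> {..<s} = (\<Union>n::nat. A \<inter> {..s - inverse (real (Suc n))})"
      proof (intro equalityI subsetI)
        fix x assume x: "x \<in> A \<inter> {..<s}"
        then obtain n where "inverse (real (Suc n)) < s - x"
          using reals_Archimedean[of "s - x"] by auto
        then show "x \<in> (\<Union>n::nat. A \<inter> {..s - inverse (real (Suc n))})"
          using x by (auto intro!: exI[of _ n] simp del: of_nat_Suc)
      next
        fix x assume "x \<in> (\<Union>n::nat. A \<inter> {..s - inverse (real (Suc n))})"
        then obtain n where "x \<in> A" "x \<le> s - inverse (real (Suc n))" by auto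
        moreover have "inverse (real (Suc n)) > 0" by simp
        ultimately show "x \<in> A \<inter> {..<s}" unfolding Int_iff lessThan_iff by linarith
      qed
      then show ?thesis by simp
    qed
    also have "\<dots> = (SUP n::nat. emeasure lborel (A \<inter> {..s - inverse (real (Suc n))}))"
    proof (rule SUP_emeasure_incseq[symmetric])
      show "incseq (\<lambda>n::nat. A \<inter> {..s - inverse (real (Suc n))})"
        unfolding incseq_def
      proof (intro allI impI Int_mono order_refl)
        fix m n :: nat assume "m \<le> n"
        then have "inverse (real (Suc n)) \<le> inverse (real (Suc m))"
          by (intro le_imp_inverse_le) auto
        then show "{..s - inverse (real (Suc m))} \<subseteq> {..s - inverse (real (Suc n))}"
          by auto
      qed
    qed auto
    finally have "emeasure lborel A + b
        \<le> (SUP n::nat. emeasure lborel (A \<inter> {..s - inverse (real (Suc n))}) + b)"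
      by (simp add: ennreal_SUP_add_left add_right_mono)
    also have "\<dots> \<le> c"
    proof (rule SUP_least)
      fix n :: nat
      have "s - inverse (real (Suc n)) < s" by simp
      then obtain k where "k \<in> A" "s - inverse (real (Suc n)) < k"
        unfolding s_def using less_cSup_iff[OF ne True] by auto
      then show "emeasure lborel (A \<inter> {..s - inverse (real (Suc n))}) + b \<le> c"
        by (intro seg) auto
    qed
    finally show ?thesis .
  qed
qed

lemma emeasure_lborel_affine_image:
  fixes c t :: real
  assumes "c \<noteq> 0" and A: "A \<in> sets borel"
  shows "emeasure lborel ((\<lambda>x. t + c * x) ` A) = ennreal \<bar>c\<bar> * emeasure lborel A"
    and "(\<lambda>x. t + c * x) ` A \<in> sets borel"
proof -
  have eq: "(\<lambda>x. t + c * x) ` A = (\<lambda>y. (y - t) / c) -` A"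
    using \<open>c \<noteq> 0\<close> by (auto simp: image_iff intro!: image_eqI[where x="(x - t) / c" for x])
  have m: "(\<lambda>y. (y - t) / c) -` A \<in> sets borel"
    using measurable_sets[of "\<lambda>y. (y - t) / c" borel borel A] A by simp
  then show "(\<lambda>x. t + c * x) ` A \<in> sets borel" by (simp add: eq)
  have "emeasure lborel ((\<lambda>x. t + c * x) ` A)
      = (\<integral>\<^sup>+y. indicator ((\<lambda>y. (y - t) / c) -` A) y \<partial>lborel)"
    using m by (simp add: eq)
  also have "\<dots> = ennreal \<bar>c\<bar> * (\<integral>\<^sup>+x. indicator ((\<lambda>y. (y - t) / c) -` A) (t + c * x) \<partial>lborel)"
    using m \<open>c \<noteq> 0\<close> by (intro nn_integral_real_affine) auto
  also have "(\<lambda>x. indicator ((\<lambda>y. (y - t) / c) -` A) (t + c * x) :: ennreal) = indicator A"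
    using \<open>c \<noteq> 0\<close> by (auto simp: indicator_def fun_eq_iff)
  finally show "emeasure lborel ((\<lambda>x. t + c * x) ` A) = ennreal \<bar>c\<bar> * emeasure lborel A"
    using A by simp
qed

text \<open>For \<open>k\<close> in \<open>A\<close> and \<open>l\<close> in \<open>B\<close>, the
  midpoints of \<open>A \<inter> {..k}\<close> with \<open>l\<close> and those of
  \<open>B \<inter> {l..}\<close> with \<open>k\<close> lie in \<open>C\<close> on opposite sides of
  \<open>(k + l) / 2\<close>, so the measures of these two half-size copies add up. Moving
  \<open>k\<close> up and \<open>l\<close> down exhausts \<open>A\<close> and
  \<open>B\<close>.\<close>

lemma brunn_minkowski_midpoint_real:
  fixes A B C :: "real set"
  assumes A[measurable]: "A \<in> sets borel" and B[measurable]: "B \<in> sets borel"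
    and C[measurable]: "C \<in> sets borel"
    and "A \<noteq> {}" "B \<noteq> {}"
    and mid: "\<And>a b. a \<in> A \<Longrightarrow> b \<in> B \<Longrightarrow> (a + b) / 2 \<in> C"
  shows "emeasure lborel A + emeasure lborel B \<le> 2 * emeasure lborel C"
proof -
  have half: "2 * (ennreal (1/2) * x) = x" for x
  proof -
    have "2 * ennreal (1/2) = ennreal (2 * (1/2))"
      by (subst ennreal_mult) auto
    then show ?thesis by (simp add: mult.assoc[symmetric])
  qed
  have disj: "Y \<inter> (Z - {m}) = {}" if "Y \<subseteq> C \<inter> {..m}" "Z \<subseteq> C \<inter> {m..}" for Y Z and m :: real
    using that by force
  have seg: "emeasure lborel (A \<inter> {..k}) + emeasure lborel (B \<inter> {l..}) \<le> 2 * emeasure lborel C"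
    if k: "k \<in> A" and l: "l \<in> B" for k l
  proof -
    let ?A = "(\<lambda>x. l/2 + (1/2) * x) ` (A \<inter> {..k})"
    let ?B = "(\<lambda>x. k/2 + (1/2) * x) ` (B \<inter> {l..})"
    have m[measurable]: "?A \<in> sets borel" "?B \<in> sets borel"
      by (rule emeasure_lborel_affine_image(2); simp)+
    have 1: "?A \<subseteq> C \<inter> {..(k + l)/2}"
      using mid[OF _ l] by (auto simp: field_simps)
    have 2: "?B \<subseteq> C \<inter> {(k + l)/2..}"
      using mid[OF k] by (auto simp: field_simps)
    have "emeasure lborel (A \<inter> {..k}) + emeasure lborel (B \<inter> {l..})
        = 2 * (emeasure lborel ?A + emeasure lborel ?B)"
      by (simp only: emeasure_lborel_affine_image(1) A B sets.Int borel_closed closed_atMost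
            closed_atLeast distrib_left) (simp add: half[simplified])
    also have "emeasure lborel ?A + emeasure lborel ?B
        = emeasure lborel ?A + emeasure lborel (?B - {(k+l)/2})"
      by (simp only: emeasure_Diff_null_set[of "{(k+l)/2}" lborel ?B] m sets_lborel
          finite_imp_null_set_lborel finite.intros)
    also have "\<dots> = emeasure lborel (?A \<union> (?B - {(k+l)/2}))"
      using disj[OF 1 2] by (intro plus_emeasure) (use m in auto)
    also have "\<dots> \<le> emeasure lborel C"
      using 1 2 by (intro emeasure_mono Un_least) (blast, blast, simp)
    finally show ?thesis by (simp add: mult_left_mono)
  qed
  have step1: "emeasure lborel A + emeasure lborel (B \<inter> {l..}) \<le> 2 * emeasure lborel C"
    if "l \<in> B" for l
    using seg[OF _ that] \<open>A \<noteq> {}\<close> by (rule emeasure_add_le_of_initial_segments[OF A])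
  \<comment> \<open>Reflection turns the final segments of \<open>B\<close> into initial ones, so
    the same limit argument applies to \<open>l\<close>.\<close>
  have neg: "emeasure lborel (uminus ` S) = emeasure lborel S" "uminus ` S \<in> sets borel"
    if "S \<in> sets borel" for S :: "real set"
    using emeasure_lborel_affine_image[of "-1" S 0] that by auto
  have "emeasure lborel (uminus ` B) + emeasure lborel A \<le> 2 * emeasure lborel C"
  proof (rule emeasure_add_le_of_initial_segments[OF neg(2)[OF B]])
    fix k assume "k \<in> uminus ` B"
    then obtain l where l: "l \<in> B" "k = - l" by auto
    have "uminus ` B \<inter> {..k} = uminus ` (B \<inter> {l..})" using l by auto
    then show "emeasure lborel (uminus ` B \<inter> {..k}) + emeasure lborel A \<le> 2 * emeasure lborel C"
      using step1[OF l(1)] by (simp add: neg add.commute)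
  qed (use \<open>B \<noteq> {}\<close> in auto)
  then show ?thesis by (simp add: neg add.commute)
qed

section \<open>Prekopa-Leindler on the real line\<close>

text \<open>Equal suprema make the superlevel sets of \<open>f\<close> and \<open>g\<close> nonempty
  for the same levels \<open>t\<close>. Brunn-Minkowski can fail when exactly one set is empty, and
  this rules that case out; integrating over \<open>t\<close> gives the additive bound.\<close>

lemma prekopa_leindler_real_equal_Sup:
  fixes f g h :: "real \<Rightarrow> ennreal"
  assumes [measurable]: "f \<in> borel_measurable borel" "g \<in> borel_measurable borel"
      "h \<in> borel_measurable borel"
    and Sup_eq: "Sup (range f) = Sup (range g)"
    and le: "\<And>x y. f x * g y \<le> (h ((x + y) / 2))\<^sup>2"
  shows "(\<integral>\<^sup>+x. f x \<partial>lborel) + (\<integral>\<^sup>+x. g x \<partial>lborel) \<le> 2 * (\<integral>\<^sup>+x. h x \<partial>lborel)"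
proof -
  have level: "emeasure lborel {x. ennreal t < f x} + emeasure lborel {x. ennreal t < g x}
      \<le> 2 * emeasure lborel {x. ennreal t < h x}" if "t \<ge> 0" for t
  proof -
    have "{x. ennreal t < f x} = {} \<longleftrightarrow> Sup (range f) \<le> ennreal t"
      "{x. ennreal t < g x} = {} \<longleftrightarrow> Sup (range g) \<le> ennreal t"
      by (auto simp: Sup_le_iff not_less)
    then consider "{x. ennreal t < f x} = {}" "{x. ennreal t < g x} = {}"
      | "{x. ennreal t < f x} \<noteq> {}" "{x. ennreal t < g x} \<noteq> {}"
      using Sup_eq by auto
    then show ?thesis
    proof cases
      case 1
      then show ?thesis by simp
    next
      case 2
      have "ennreal t < h ((x + y) / 2)" if lt: "ennreal t < f x" "ennreal t < g y" for x y
      proof -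
        \<comment> \<open>The values may be infinite. Finite numbers strictly in between allow the
          strict inequalities to be multiplied in the reals.\<close>
        obtain r s where r: "ennreal t < r" "r < f x" and s: "ennreal t < s" "s < g y"
          using dense[OF lt(1)] dense[OF lt(2)] by auto
        then have "r \<noteq> top" "s \<noteq> top" by (metis top.extremum_strict)+
        then obtain r' s' where rs: "r = ennreal r'" "s = ennreal s'" "r' \<ge> 0" "s' \<ge> 0"
          by (metis ennreal_cases)
        then have "t < r'" "t < s'" using r s \<open>t \<ge> 0\<close> by (auto simp: ennreal_less_iff)
        then have "t\<^sup>2 < r' * s'"
          using \<open>t \<ge> 0\<close> unfolding power2_eq_square by (intro mult_strict_mono') auto
        then have "(ennreal t)\<^sup>2 < r * s"
          using rs \<open>t \<ge> 0\<close> by (simp add: ennreal_power ennreal_mult[symmetric] ennreal_less_iff)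
        also have "\<dots> \<le> f x * g y" using r s by (intro mult_mono) auto
        also have "\<dots> \<le> (h ((x + y) / 2))\<^sup>2" by (rule le)
        finally show ?thesis
          by (meson not_less power_mono zero_le)
      qed
      then show ?thesis
        using 2 by (intro brunn_minkowski_midpoint_real) auto
    qed
  qed
  have cake: "(\<integral>\<^sup>+x. k x \<partial>lborel) = (\<integral>\<^sup>+t\<in>{0..}. emeasure lborel {x. ennreal t < k x} \<partial>lborel)"
    if "k \<in> borel_measurable borel" for k :: "real \<Rightarrow> ennreal"
    using nn_integral_layer_cake[of lborel k] that by (simp add: sigma_finite_lborel)
  have meas: "(\<lambda>t::real. emeasure lborel {x. ennreal t < k x}) \<in> borel_measurable borel"
    if [measurable]: "k \<in> borel_measurable borel" for k :: "real \<Rightarrow> ennreal"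
    by measurable
  have "(\<integral>\<^sup>+x. f x \<partial>lborel) + (\<integral>\<^sup>+x. g x \<partial>lborel)
      = (\<integral>\<^sup>+t\<in>{0..}. (emeasure lborel {x. ennreal t < f x} + emeasure lborel {x. ennreal t < g x}) \<partial>lborel)"
    unfolding cake[OF assms(1)] cake[OF assms(2)] distrib_right
    by (rule nn_integral_add[symmetric]) (use meas assms in auto)
  also have "\<dots> \<le> (\<integral>\<^sup>+t\<in>{0..}. 2 * emeasure lborel {x. ennreal t < h x} \<partial>lborel)"
    by (rule nn_integral_mono) (auto simp: indicator_def level)
  also have "\<dots> = 2 * (\<integral>\<^sup>+x. h x \<partial>lborel)"
    unfolding cake[OF assms(3)] mult.assoc
    by (rule nn_integral_cmult) (use meas assms in auto)
  finally show ?thesis .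
qed

lemma mult_le_square_mean: "p * q \<le> ((p + q) / 2)\<^sup>2" for p q :: real
proof -
  have "((p + q) / 2)\<^sup>2 - p * q = ((p - q) / 2)\<^sup>2" by (simp add: power2_eq_square field_simps)
  then show ?thesis using zero_le_power2[of "(p - q) / 2"] by linarith
qed

text \<open>Rescaling \<open>f\<close> and \<open>g\<close> by reciprocal factors equalises their suprema; AM-GM does the rest.\<close>

lemma prekopa_leindler_real_bounded:
  fixes f g h :: "real \<Rightarrow> ennreal"
  assumes [measurable]: "f \<in> borel_measurable borel" "g \<in> borel_measurable borel"
      "h \<in> borel_measurable borel"
    and bnd: "\<And>x. f x \<le> ennreal c" "\<And>x. g x \<le> ennreal c"
    and le: "\<And>x y. f x * g y \<le> (h ((x + y) / 2))\<^sup>2"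
  shows "(\<integral>\<^sup>+x. f x \<partial>lborel) * (\<integral>\<^sup>+x. g x \<partial>lborel) \<le> (\<integral>\<^sup>+x. h x \<partial>lborel)\<^sup>2"
proof -
  have "Sup (range f) \<le> ennreal c" "Sup (range g) \<le> ennreal c"
    using bnd by (auto intro: SUP_least)
  then have "Sup (range f) \<noteq> top" "Sup (range g) \<noteq> top"
    using neq_top_trans[OF ennreal_neq_top] by blast+
  then obtain a b where a: "Sup (range f) = ennreal a" "a \<ge> 0"
      and b: "Sup (range g) = ennreal b" "b \<ge> 0"
    by (metis ennreal_cases)
  show ?thesis
  proof (cases "a = 0 \<or> b = 0")
    case True
    then have "(\<forall>x. f x = 0) \<or> (\<forall>x. g x = 0)"
      using a b by (auto simp: SUP_eq_iff bot_ennreal[symmetric])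
    then show ?thesis by auto
  next
    case False
    then have pos: "a > 0" "b > 0" using a b by auto
    define l where "l = sqrt (b / a)"
    have l: "l > 0" using pos by (simp add: l_def)
    define F G H where "F = (\<integral>\<^sup>+x. f x \<partial>lborel)" and "G = (\<integral>\<^sup>+x. g x \<partial>lborel)"
      and "H = (\<integral>\<^sup>+x. h x \<partial>lborel)"
    have "ennreal l * F + ennreal (1/l) * G \<le> 2 * H"
    proof -
      have "l * l = b / a" using pos by (simp add: l_def)
      then have "l * a = (1 / l) * b" using l pos by (simp add: field_simps)
      then have "Sup (range (\<lambda>x. ennreal l * f x)) = Sup (range (\<lambda>x. ennreal (1/l) * g x))"
        using a b l by (simp add: SUP_mult_left_ennreal[symmetric] ennreal_mult[symmetric])
      moreover have "(ennreal l * f x) * (ennreal (1/l) * g y) \<le> (h ((x + y) / 2))\<^sup>2" for x y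
      proof -
        have "ennreal l * ennreal (1/l) = 1"
          using l by (simp add: ennreal_mult[symmetric])
        then have "(ennreal l * f x) * (ennreal (1/l) * g y) = f x * g y"
          by (metis mult.assoc mult.commute mult.right_neutral)
        then show ?thesis using le by simp
      qed
      ultimately have "(\<integral>\<^sup>+x. ennreal l * f x \<partial>lborel) + (\<integral>\<^sup>+x. ennreal (1/l) * g x \<partial>lborel) \<le> 2 * H"
        unfolding H_def by (intro prekopa_leindler_real_equal_Sup) auto
      then show ?thesis by (simp add: nn_integral_cmult F_def G_def)
    qed
    moreover have "F * G \<le> H\<^sup>2" if "H \<noteq> top"
      and le': "ennreal l * F + ennreal (1/l) * G \<le> 2 * H"
    proof -
      have "2 * H \<noteq> top" using that by (simp add: ennreal_mult_eq_top_iff)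
      then have "ennreal l * F + ennreal (1/l) * G \<noteq> top" using le' by (auto simp: top_unique)
      then have "F \<noteq> top" "G \<noteq> top" using l by (auto simp: ennreal_mult_eq_top_iff)
      then obtain F' G' H' where r: "F = ennreal F'" "G = ennreal G'" "H = ennreal H'"
          "F' \<ge> 0" "G' \<ge> 0" "H' \<ge> 0"
        using \<open>H \<noteq> top\<close> by (metis ennreal_cases)
      have "ennreal (l * F' + 1/l * G') = ennreal l * F + ennreal (1/l) * G"
        using r l by (simp only: ennreal_mult ennreal_plus less_imp_le mult_nonneg_nonneg
            zero_le_divide_1_iff)
      moreover have "2 * H = ennreal (2 * H')"
        using r by (simp add: ennreal_mult)
      ultimately have "ennreal (l * F' + 1/l * G') \<le> ennreal (2 * H')" using le' by metis
      then have "l * F' + 1/l * G' \<le> 2 * H'" using r by (simp add: ennreal_le_iff)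
      then have "((l * F' + 1/l * G') / 2)\<^sup>2 \<le> H'\<^sup>2"
        using r l by (intro power_mono) auto
      moreover have "(l * F') * (1/l * G') \<le> ((l * F' + 1/l * G') / 2)\<^sup>2"
        by (rule mult_le_square_mean)
      moreover have "(l * F') * (1/l * G') = F' * G'" using l by simp
      ultimately have "F' * G' \<le> H'\<^sup>2" by (metis order_trans)
      then show ?thesis using r by (simp add: ennreal_mult[symmetric] ennreal_power)
    qed
    ultimately have "F * G \<le> H\<^sup>2" by (cases "H = top") auto
    then show ?thesis by (simp only: F_def G_def H_def)
  qed
qed

text \<open>Truncating \<open>f\<close> and \<open>g\<close> preserves the hypothesis with the same
  \<open>h\<close>. Independent truncation levels let the two suprema from monotone convergence be
  taken one after the other.\<close>

lemma prekopa_leindler_real: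
  fixes f g h :: "real \<Rightarrow> ennreal"
  assumes [measurable]: "f \<in> borel_measurable borel" "g \<in> borel_measurable borel"
      "h \<in> borel_measurable borel"
    and le: "\<And>x y. f x * g y \<le> (h ((x + y) / 2))\<^sup>2"
  shows "(\<integral>\<^sup>+x. f x \<partial>lborel) * (\<integral>\<^sup>+x. g x \<partial>lborel) \<le> (\<integral>\<^sup>+x. h x \<partial>lborel)\<^sup>2"
proof -
  have trunc: "(\<integral>\<^sup>+x. k x \<partial>lborel) = (SUP n::nat. \<integral>\<^sup>+x. min (k x) (ennreal (real n)) \<partial>lborel)"
    if [measurable]: "k \<in> borel_measurable borel" for k :: "real \<Rightarrow> ennreal"
  proof -
    have "(SUP n::nat. min (k x) (ennreal (real n))) = k x" for x
    proof -
      have "(SUP n::nat. min (k x) (ennreal (real n))) = inf (k x) (SUP n::nat. of_nat n)"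
        by (simp add: inf_min[symmetric] inf_SUP ennreal_of_nat_eq_real_of_nat)
      then show ?thesis by (simp add: ennreal_SUP_of_nat_eq_top)
    qed
    then have "(\<integral>\<^sup>+x. k x \<partial>lborel) = (\<integral>\<^sup>+x. (SUP n::nat. min (k x) (ennreal (real n))) \<partial>lborel)"
      by simp
    also have "\<dots> = (SUP n::nat. \<integral>\<^sup>+x. min (k x) (ennreal (real n)) \<partial>lborel)"
      by (rule nn_integral_monotone_convergence_SUP)
        (auto simp: incseq_def le_fun_def min.coboundedI2)
    finally show ?thesis .
  qed
  have "(\<integral>\<^sup>+x. min (f x) (ennreal (real m)) \<partial>lborel) * (\<integral>\<^sup>+x. min (g x) (ennreal (real n)) \<partial>lborel)
      \<le> (\<integral>\<^sup>+x. h x \<partial>lborel)\<^sup>2" for m n :: nat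
  proof (rule prekopa_leindler_real_bounded[where c="real (max m n)"])
    fix x y :: real
    show "min (f x) (ennreal (real m)) * min (g y) (ennreal (real n)) \<le> (h ((x + y) / 2))\<^sup>2"
      by (rule order_trans[OF mult_mono le]) auto
  qed (auto simp: min.coboundedI2)
  then have "(\<integral>\<^sup>+x. min (f x) (ennreal (real m)) \<partial>lborel) * (\<integral>\<^sup>+x. g x \<partial>lborel)
      \<le> (\<integral>\<^sup>+x. h x \<partial>lborel)\<^sup>2" for m :: nat
    unfolding trunc[of g, OF assms(2)] SUP_mult_left_ennreal by (intro SUP_least)
  then show ?thesis
    unfolding trunc[of f, OF assms(1)] SUP_mult_right_ennreal by (intro SUP_least)
qed

section \<open>Tensorisation to product measures\<close>

text \<open>Integrating out one coordinate preserves the hypothesis: for fixed remaining coordinates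
  it is the one-dimensional inequality for the sections. The marginals therefore satisfy the
  induction hypothesis.\<close>

lemma prekopa_leindler_PiM:
  fixes f g h :: "('i \<Rightarrow> real) \<Rightarrow> ennreal"
  assumes "finite I"
    and "f \<in> borel_measurable (Pi\<^sub>M I (\<lambda>_. lborel))" "g \<in> borel_measurable (Pi\<^sub>M I (\<lambda>_. lborel))"
      "h \<in> borel_measurable (Pi\<^sub>M I (\<lambda>_. lborel))"
    and "\<And>x y. x \<in> I \<rightarrow>\<^sub>E UNIV \<Longrightarrow> y \<in> I \<rightarrow>\<^sub>E UNIV \<Longrightarrow> f x * g y \<le> (h (\<lambda>i\<in>I. (x i + y i) / 2))\<^sup>2"
  shows "(\<integral>\<^sup>+x. f x \<partial>Pi\<^sub>M I (\<lambda>_. lborel)) * (\<integral>\<^sup>+x. g x \<partial>Pi\<^sub>M I (\<lambda>_. lborel))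
    \<le> (\<integral>\<^sup>+x. h x \<partial>Pi\<^sub>M I (\<lambda>_. lborel))\<^sup>2"
  using assms
proof (induction I arbitrary: f g h rule: finite_induct)
  case empty
  interpret product_sigma_finite "\<lambda>_::'i. lborel :: real measure" ..
  \<comment> \<open>The empty product is the one-point space containing \<open>?u\<close>, where
    integrals are point values.\<close>
  let ?u = "\<lambda>_::'i. undefined :: real"
  have "f ?u * g ?u \<le> (h (\<lambda>i\<in>{}. (?u i + ?u i) / 2))\<^sup>2"
    by (rule empty.prems(4)) auto
  moreover have "(\<lambda>i\<in>{}. (?u i + ?u i) / 2) = ?u" by auto
  ultimately show ?case by (simp only: nn_integral_empty zero_le)
next
  case (insert i I)
  interpret product_sigma_finite "\<lambda>_::'i. lborel :: real measure" ..
  note [measurable] = insert.prems(1-3)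
  let ?M = "Pi\<^sub>M I (\<lambda>_. lborel :: real measure)"
  have sec: "(\<lambda>y. k (x(i := y))) \<in> borel_measurable lborel"
    if [measurable]: "k \<in> borel_measurable (Pi\<^sub>M (insert i I) (\<lambda>_. lborel))" and x: "x \<in> I \<rightarrow>\<^sub>E UNIV"
    for k :: "('i \<Rightarrow> real) \<Rightarrow> ennreal" and x
  proof -
    have "x \<in> space ?M" using x by (simp add: space_PiM)
    then show ?thesis by measurable
  qed
  have marg: "(\<lambda>x. \<integral>\<^sup>+y. k (x(i := y)) \<partial>lborel) \<in> borel_measurable ?M"
    if [measurable]: "k \<in> borel_measurable (Pi\<^sub>M (insert i I) (\<lambda>_. lborel))"
    for k :: "('i \<Rightarrow> real) \<Rightarrow> ennreal"
    by measurable
  have "(\<integral>\<^sup>+x. \<integral>\<^sup>+y. f (x(i := y)) \<partial>lborel \<partial>?M) * (\<integral>\<^sup>+x. \<integral>\<^sup>+y. g (x(i := y)) \<partial>lborel \<partial>?M)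
      \<le> (\<integral>\<^sup>+x. \<integral>\<^sup>+y. h (x(i := y)) \<partial>lborel \<partial>?M)\<^sup>2"
  proof (rule insert.IH)
    fix x x' :: "'i \<Rightarrow> real" assume x: "x \<in> I \<rightarrow>\<^sub>E UNIV" "x' \<in> I \<rightarrow>\<^sub>E UNIV"
    let ?m = "\<lambda>j\<in>I. (x j + x' j) / 2"
    have m: "?m \<in> I \<rightarrow>\<^sub>E UNIV" by simp
    show "(\<integral>\<^sup>+y. f (x(i := y)) \<partial>lborel) * (\<integral>\<^sup>+y. g (x'(i := y)) \<partial>lborel)
        \<le> (\<integral>\<^sup>+y. h (?m(i := y)) \<partial>lborel)\<^sup>2"
    proof (rule prekopa_leindler_real)
      fix y y' :: real
      have "(\<lambda>j\<in>insert i I. ((x(i := y)) j + (x'(i := y')) j) / 2) = ?m(i := (y + y') / 2)"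
        using \<open>i \<notin> I\<close> by (auto simp: fun_eq_iff)
      moreover have "f (x(i := y)) * g (x'(i := y'))
          \<le> (h (\<lambda>j\<in>insert i I. ((x(i := y)) j + (x'(i := y')) j) / 2))\<^sup>2"
        using x by (intro insert.prems(4)) (auto simp: PiE_iff extensional_def)
      ultimately show "f (x(i := y)) * g (x'(i := y')) \<le> (h (?m(i := (y + y') / 2)))\<^sup>2"
        by (simp only:)
    qed (use sec[OF insert.prems(1) x(1)] sec[OF insert.prems(2) x(2)] sec[OF insert.prems(3) m] in \<open>simp_all del: fun_upd_apply\<close>)
  qed (use marg[OF insert.prems(1)] marg[OF insert.prems(2)] marg[OF insert.prems(3)] in \<open>simp_all del: fun_upd_apply\<close>)
  then show ?case
    by (simp only: product_nn_integral_insert[OF insert.hyps] insert.prems(1-3))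
qed

section \<open>Cutting a convex set through its centroid\<close>

text \<open>The thresholds \<open>(2 ^ k - 1) * a\<close> cut the half-line into intervals of length
  \<open>2 ^ k * a\<close>. For \<open>y \<ge> 0\<close> the sum of the lengths whose left ends are
  passed is the right end of the interval containing \<open>y\<close>. The indicator form matters
  because integration turns it into tail measures.\<close>

lemma dyadic_step_bound:
  fixes y a :: real
  assumes "a > 0" and "y < (2 ^ n - 1) * a"
  shows "y \<le> (\<Sum>k<n. 2 ^ k * a * of_bool ((2 ^ k - 1) * a \<le> y)) - a / 2 * of_bool (y < - a / 2)"
proof -
  have nonneg: "0 \<le> (\<Sum>k<m. 2 ^ k * a * of_bool ((2 ^ k - 1) * a \<le> y))" for m :: nat
    using \<open>a > 0\<close> by (intro sum_nonneg) auto
  have "y \<le> (\<Sum>k<n. 2 ^ k * a * of_bool ((2 ^ k - 1) * a \<le> y))" if "y \<ge> 0"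
    using assms(2)
  proof (induction n)
    case 0
    then show ?case using that by simp
  next
    case (Suc n)
    show ?case
    proof (cases "y < (2 ^ n - 1) * a")
      case True
      then have "y \<le> (\<Sum>k<n. 2 ^ k * a * of_bool ((2 ^ k - 1) * a \<le> y))" by (rule Suc.IH)
      also have "\<dots> \<le> (\<Sum>k<Suc n. 2 ^ k * a * of_bool ((2 ^ k - 1) * a \<le> y))"
        using \<open>a > 0\<close> by simp
      finally show ?thesis .
    next
      case False
      have "(2 ^ k - 1) * a \<le> y" if "k < Suc n" for k
      proof -
        have "(2 ^ k :: real) \<le> 2 ^ n" using that by (intro power_increasing) auto
        then have "(2 ^ k - 1) * a \<le> (2 ^ n - 1) * a" using \<open>a > 0\<close> by simp
        then show ?thesis using False by simp
      qed
      then have "(\<Sum>k<Suc n. 2 ^ k * a * of_bool ((2 ^ k - 1) * a \<le> y)) = (\<Sum>k<Suc n. 2 ^ k * a)"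
        by (intro sum.cong) auto
      also have "\<dots> = (2 ^ Suc n - 1) * a"
        by (simp only: sum_distrib_right[symmetric] geometric_sum) (simp add: geometric_sum)
      finally show ?thesis using Suc.prems by simp
    qed
  qed
  then show ?thesis
    using nonneg[of n] \<open>a > 0\<close> by (cases "y \<ge> 0") (auto simp: of_bool_def)
qed

text \<open>If \<open>\<phi> \<ge> 0\<close> had small measure, pick a dyadic \<open>a\<close> such that \<open>-a\<close> lies below and \<open>-a / 2\<close>
  above the median.  The negative part then contributes at least \<open>a / 4\<close> to the mean, while
  midpoint log-concavity, applied to \<open>-a\<close> and \<open>(2 ^ Suc k - 1) a\<close>, makes the tail decay so fast that
  the positive part contributes at most \<open>a / 6\<close>.\<close>

lemma (in finite_measure) measure_nonneg_ge_of_log_concave_tail: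
  fixes \<phi> :: "'a \<Rightarrow> real"
  assumes [measurable]: "\<phi> \<in> borel_measurable M"
    and bnd: "\<And>x. x \<in> space M \<Longrightarrow> \<bar>\<phi> x\<bar> \<le> 1"
    and log_concave: "\<And>s t. measure M {x \<in> space M. s \<le> \<phi> x} * measure M {x \<in> space M. t \<le> \<phi> x}
      \<le> (measure M {x \<in> space M. (s + t) / 2 \<le> \<phi> x})\<^sup>2"
    and mean: "0 \<le> (\<integral>x. \<phi> x \<partial>M)"
  shows "measure M (space M) / 10 \<le> measure M {x \<in> space M. 0 \<le> \<phi> x}"
proof (rule ccontr)
  define V G where "V = measure M (space M)" and "G s = measure M {x \<in> space M. s \<le> \<phi> x}" for s
  assume "\<not> ?thesis"
  then have small: "G 0 < V / 10" by (simp add: V_def G_def)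
  have G_nonneg: "G s \<ge> 0" for s by (simp add: G_def)
  have V: "V > 0" using small G_nonneg[of 0] by simp
  \<comment> \<open>The closed tails at the levels \<open>- 2 / 2 ^ n\<close> shrink to the tail at
    0, whose measure is below \<open>V / 2\<close>; hence some dyadic level already lies above the
    median.\<close>
  have "(\<lambda>n. G (- 2 / 2 ^ n)) \<longlonglongrightarrow> measure M (\<Inter>n. {x \<in> space M. - 2 / 2 ^ n \<le> \<phi> x})"
    unfolding G_def
  proof (rule finite_Lim_measure_decseq)
    show "decseq (\<lambda>n. {x \<in> space M. - 2 / 2 ^ n \<le> \<phi> x})"
    proof (rule decseq_SucI, safe)
      fix n x assume "- 2 / 2 ^ Suc n \<le> \<phi> x"
      moreover have "- 2 / 2 ^ n \<le> - 2 / (2 ^ Suc n :: real)"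
        by (simp add: field_simps)
      ultimately show "- 2 / 2 ^ n \<le> \<phi> x" by linarith
    qed
  qed auto
  also have "(\<Inter>n. {x \<in> space M. - 2 / 2 ^ n \<le> \<phi> x}) = {x \<in> space M. 0 \<le> \<phi> x}"
  proof safe
    fix x assume x: "x \<in> (\<Inter>n. {x \<in> space M. - 2 / 2 ^ n \<le> \<phi> x})"
    then show "x \<in> space M" by auto
    have "(\<lambda>n. - 2 * (1 / 2) ^ n :: real) \<longlonglongrightarrow> - 2 * 0"
      by (intro tendsto_intros LIMSEQ_realpow_zero) auto
    moreover have "- 2 * (1 / 2) ^ n \<le> \<phi> x" for n
      using x by (auto simp: power_one_over)
    ultimately have "- 2 * 0 \<le> \<phi> x"
      by (intro LIMSEQ_le_const2) auto
    then show "0 \<le> \<phi> x" by simp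
  next
    fix x n assume "0 \<le> \<phi> x"
    have "- 2 / 2 ^ n \<le> (0 :: real)" by simp
    then show "- 2 / 2 ^ n \<le> \<phi> x" using \<open>0 \<le> \<phi> x\<close> by linarith
  qed
  finally have "(\<lambda>n. G (- 2 / 2 ^ n)) \<longlonglongrightarrow> G 0" by (simp add: G_def)
  moreover have "G 0 < V / 2" using small V by simp
  ultimately have "\<forall>\<^sub>F n in sequentially. G (- 2 / 2 ^ n) < V / 2" by (rule order_tendstoD(2))
  then have ex: "\<exists>n. G (- 2 / 2 ^ n) \<le> V / 2"
    by (meson eventually_sequentially less_imp_le order_refl)
  \<comment> \<open>The level for index 0 is -2, below all values of \<open>\<phi>\<close>, so its
    tail has full measure. Thus \<open>m\<close> is positive and its predecessor supplies the level
    \<open>- a\<close>.\<close>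
  define m where "m = (LEAST n. G (- 2 / 2 ^ n) \<le> V / 2)"
  have m: "G (- 2 / 2 ^ m) \<le> V / 2" unfolding m_def by (rule LeastI_ex[OF ex])
  have "{x \<in> space M. - 2 \<le> \<phi> x} = space M" using bnd by force
  then have "G (- 2 / 2 ^ 0) = V" by (simp add: G_def V_def)
  then have "m \<noteq> 0" using m V by (intro notI) simp
  then obtain m' where m': "m = Suc m'" by (cases m) auto
  have above: "V / 2 < G (- 2 / 2 ^ m')"
    using not_less_Least[of m' "\<lambda>n. G (- 2 / 2 ^ n) \<le> V / 2"] m' by (simp add: m_def)
  define a :: real where "a = 2 / 2 ^ m'"
  have a: "a > 0" "V / 2 < G (- a)" "G (- a / 2) \<le> V / 2"
    using above m by (simp_all add: a_def m')
  \<comment> \<open>One factor of the square is at most \<open>V / 10\<close>, the other is bounded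
    by induction. Dividing by \<open>V / 2\<close>, a lower bound for \<open>G (- a)\<close>, leaves
    the ratio \<open>(1 / 10) / (1 / 2) = 1 / 5\<close>.\<close>
  have decay: "G ((2 ^ k - 1) * a) \<le> V / 10 * (1 / 5) ^ k" for k :: nat
  proof (induction k)
    case 0
    then show ?case using small by simp
  next
    case (Suc k)
    let ?g = "G ((2 ^ k - 1) * a)"
    have "G ((2 ^ Suc k - 1) * a) * (V / 2) \<le> G ((2 ^ Suc k - 1) * a) * G (- a)"
      using a(2) G_nonneg by (intro mult_left_mono) auto
    also have "\<dots> \<le> (G (((2 ^ Suc k - 1) * a + (- a)) / 2))\<^sup>2"
      unfolding G_def by (rule log_concave)
    also have "((2 ^ Suc k - 1) * a + (- a)) / 2 = (2 ^ k - 1) * a" by (simp add: field_simps)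
    also have "?g\<^sup>2 \<le> (V / 10) * (V / 10 * (1 / 5) ^ k)"
    proof -
      have "V / 10 * (1 / 5) ^ k \<le> V / 10 * 1"
        using V by (intro mult_left_mono power_le_one) auto
      then have "?g \<le> V / 10" using Suc by linarith
      then show ?thesis
        unfolding power2_eq_square using Suc V by (intro mult_mono G_nonneg) auto
    qed
    also have "\<dots> = (V / 10 * (1 / 5) ^ Suc k) * (V / 2)" by simp
    finally show ?case by (rule mult_right_le_imp_le) (use V in simp)
  qed
  \<comment> \<open>The threshold with index \<open>n\<close> exceeds 1, the largest possible value
    of \<open>\<phi>\<close>, so finitely many steps suffice.\<close>
  obtain n :: nat where "1 + 1 / a < 2 ^ n"
    using real_arch_pow[of 2 "1 + 1 / a"] by auto
  then have n: "1 < (2 ^ n - 1) * a" using a(1) by (simp add: field_simps)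
  have int: "integrable M (\<lambda>x. of_bool (s \<le> \<phi> x) :: real)"
      "integrable M (\<lambda>x. of_bool (\<phi> x < s) :: real)" for s
    by (intro integrable_const_bound[where B=1]; auto)+
  have eval: "(\<integral>x. of_bool (s \<le> \<phi> x) \<partial>M) = G s" "(\<integral>x. of_bool (\<phi> x < s) \<partial>M) = V - G s" for s
  proof -
    have "(\<integral>x. of_bool (s \<le> \<phi> x) \<partial>M) = (\<integral>x. indicator {x \<in> space M. s \<le> \<phi> x} x \<partial>M)"
      by (intro Bochner_Integration.integral_cong) (auto simp: indicator_def)
    also have "\<dots> = measure M ({x \<in> space M. s \<le> \<phi> x} \<inter> space M)"
      by (rule Bochner_Integration.integral_indicator)
    also have "\<dots> = G s" unfolding G_def by (rule arg_cong[where f="measure M"]) auto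
    finally show *: "(\<integral>x. of_bool (s \<le> \<phi> x) \<partial>M) = G s" .
    have "(\<integral>x. of_bool (\<phi> x < s) \<partial>M) = (\<integral>x. (1 - of_bool (s \<le> \<phi> x) :: real) \<partial>M)"
      by (intro Bochner_Integration.integral_cong) auto
    also have "\<dots> = (\<integral>x. (1 :: real) \<partial>M) - (\<integral>x. of_bool (s \<le> \<phi> x) \<partial>M)"
      by (rule Bochner_Integration.integral_diff[OF _ int(1)]) simp
    also have "\<dots> = V - G s" by (simp add: * V_def)
    finally show "(\<integral>x. of_bool (\<phi> x < s) \<partial>M) = V - G s" .
  qed
  have "(\<integral>x. \<phi> x \<partial>M) \<le> (\<integral>x. (\<Sum>k<n. 2 ^ k * a * of_bool ((2 ^ k - 1) * a \<le> \<phi> x))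
      - a / 2 * of_bool (\<phi> x < - a / 2) \<partial>M)"
  proof (rule integral_mono)
    show "integrable M \<phi>" by (rule integrable_const_bound[where B=1]) (use bnd in auto)
    fix x assume "x \<in> space M"
    then have "\<phi> x < (2 ^ n - 1) * a" using bnd[of x] n by linarith
    then show "\<phi> x \<le> (\<Sum>k<n. 2 ^ k * a * of_bool ((2 ^ k - 1) * a \<le> \<phi> x))
      - a / 2 * of_bool (\<phi> x < - a / 2)"
      by (rule dyadic_step_bound[OF a(1)])
  qed (intro Bochner_Integration.integrable_diff Bochner_Integration.integrable_sum
      integrable_mult_right int)
  also have "\<dots> = (\<Sum>k<n. 2 ^ k * a * G ((2 ^ k - 1) * a)) - a / 2 * (V - G (- a / 2))"
    by (simp only: Bochner_Integration.integral_diff Bochner_Integration.integral_sum int eval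
        Bochner_Integration.integrable_sum integrable_mult_right Bochner_Integration.integral_mult_right_zero)
  \<comment> \<open>Weights \<open>2 ^ k\<close> against decay \<open>(1 / 5) ^ k\<close> leave a
    geometric series of ratio 2/5 and sum at most 5/3. So the gain is at most
    \<open>a * V / 6\<close> and the loss at least \<open>a * V / 4\<close>; this gap is what makes
    the fraction 1/10 work.\<close>
  also have "\<dots> \<le> (\<Sum>k<n. 2 ^ k * a * (V / 10 * (1 / 5) ^ k)) - a / 2 * (V / 2)"
    using decay a by (intro diff_mono sum_mono mult_left_mono) auto
  also have "(\<Sum>k<n. 2 ^ k * a * (V / 10 * (1 / 5) ^ k)) = a * V / 10 * (\<Sum>k<n. (2 / 5) ^ k)"
    by (simp add: sum_distrib_left power_divide field_simps)
  also have "a * V / 10 * (\<Sum>k<n. (2 / 5) ^ k) \<le> a * V / 10 * (5 / 3)"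
  proof (rule mult_left_mono)
    have "(\<Sum>k<n. (2 / 5 :: real) ^ k) = ((2 / 5) ^ n - 1) / (2 / 5 - 1)"
      by (rule geometric_sum) simp
    also have "\<dots> \<le> 5 / 3" by (simp add: divide_simps)
    finally show "(\<Sum>k<n. (2 / 5 :: real) ^ k) \<le> 5 / 3" .
  qed (use a V in simp)
  also have "a * V / 10 * (5 / 3) - a / 2 * (V / 2) = - (a * V / 12)" by (simp add: field_simps)
  also have "\<dots> < 0" using a V by simp
  finally show False using mean by simp
qed

text \<open>By Fubini: once the other coordinates are fixed, at most one value of \<open>w i\<close>
  remains.\<close>

lemma null_set_PiM_coordinates_equal:
  assumes "finite I" "i \<in> I" "j \<in> I" "i \<noteq> j"
  shows "{w \<in> space (Pi\<^sub>M I (\<lambda>_. lborel)). w i = (w j :: real)} \<in> null_sets (Pi\<^sub>M I (\<lambda>_. lborel))"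
proof -
  interpret product_sigma_finite "\<lambda>_::'a. lborel :: real measure" ..
  define J where "J = I - {i}"
  have I: "I = insert i J" "i \<notin> J" "finite J" "j \<in> J" using assms by (auto simp: J_def)
  let ?M = "Pi\<^sub>M I (\<lambda>_. lborel :: real measure)"
  let ?N = "{w \<in> space ?M. w i = w j}"
  have N: "?N \<in> sets ?M"
    using assms by (intro borel_measurable_eq measurable_component_singleton[where M="\<lambda>_. lborel", simplified]) auto
  have "emeasure ?M ?N = (\<integral>\<^sup>+w. indicator ?N w \<partial>?M)" using N by simp
  also have "\<dots> = (\<integral>\<^sup>+x. \<integral>\<^sup>+y. indicator ?N (x(i := y)) \<partial>lborel \<partial>Pi\<^sub>M J (\<lambda>_. lborel))"
    using product_nn_integral_insert[OF I(3,2), of "indicator ?N"] N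
    unfolding I(1)[symmetric] by simp
  also have "\<dots> = (\<integral>\<^sup>+x. 0 \<partial>Pi\<^sub>M J (\<lambda>_. lborel :: real measure))"
  proof (rule nn_integral_cong)
    fix x
    have "(\<integral>\<^sup>+y. indicator ?N (x(i := y)) \<partial>lborel) \<le> (\<integral>\<^sup>+y. indicator {x j} y \<partial>lborel)"
      using \<open>i \<noteq> j\<close> by (intro nn_integral_mono) (auto simp: indicator_def)
    then show "(\<integral>\<^sup>+y. indicator ?N (x(i := y)) \<partial>lborel) = 0" by simp
  qed
  finally show ?thesis using N by (auto simp: null_sets_def)
qed

text \<open>The tail lemma is applied to \<open>w j - w i\<close> under the measure restricted to
  \<open>S\<close>; its mean is nonnegative by assumption. Since this functional is linear and
  \<open>S\<close> is closed under midpoints, the indicators of its tails satisfy the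
  Prekopa-Leindler hypothesis, which gives log-concavity.\<close>

lemma measure_halfspace_le_of_centroid:
  fixes S :: "('i \<Rightarrow> real) set" and I :: "'i set"
  defines "M \<equiv> Pi\<^sub>M I (\<lambda>_. lborel)"
  assumes I: "finite I" "i \<in> I" "j \<in> I" "i \<noteq> j"
    and S: "S \<in> sets M" "S \<subseteq> I \<rightarrow>\<^sub>E {0..1}"
    and midpoint: "\<And>x y. x \<in> S \<Longrightarrow> y \<in> S \<Longrightarrow> (\<lambda>k\<in>I. (x k + y k) / 2) \<in> S"
    and mean: "(LINT w:S|M. w i) \<le> (LINT w:S|M. w j)"
  shows "measure M {w \<in> S. w j \<le> w i} \<le> 9 / 10 * measure M S"
proof -
  interpret product_sigma_finite "\<lambda>_::'i. lborel :: real measure" ..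
  have coord[measurable]: "(\<lambda>w. w k) \<in> borel_measurable M" if "k \<in> I" for k
    using that unfolding M_def by (rule measurable_component_singleton[where M="\<lambda>_. lborel", simplified])
  have "emeasure M S \<le> emeasure M (I \<rightarrow>\<^sub>E {0..1})"
    using S I unfolding M_def by (intro emeasure_mono sets_PiM_I_finite) auto
  also have "\<dots> = 1" using I unfolding M_def by (subst emeasure_PiM) auto
  finally have fin: "emeasure M S \<noteq> \<infinity>" by (auto simp: top_unique)
  define N where "N = restrict_space M S"
  have space_N: "space N = S"
    using S sets.sets_into_space[OF S(1)] by (auto simp: N_def space_restrict_space)
  have meas_N: "emeasure N A = emeasure M A" "measure N A = measure M A" if "A \<subseteq> S" for A
    using S(1) that by (auto simp: N_def emeasure_restrict_space measure_restrict_space)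
  interpret N: finite_measure N
    by standard (use fin in \<open>simp add: space_N meas_N\<close>)
  have coord_N[measurable]: "(\<lambda>w. w k) \<in> borel_measurable N" if "k \<in> I" for k
    unfolding N_def using coord[OF that] by (rule measurable_restrict_space1)
  have tail_sets: "{w \<in> S. s \<le> w j - w i} \<in> sets M" for s
  proof -
    have "{w \<in> S. s \<le> w j - w i} = S \<inter> {w \<in> space M. s \<le> w j - w i}"
      using sets.sets_into_space[OF S(1)] by auto
    moreover have "{w \<in> space M. s \<le> w j - w i} \<in> sets M" using I by measurable
    ultimately show ?thesis using S(1) by auto
  qed
  have log_concave: "measure M {w \<in> S. s \<le> w j - w i} * measure M {w \<in> S. t \<le> w j - w i}
      \<le> (measure M {w \<in> S. (s + t) / 2 \<le> w j - w i})\<^sup>2" for s t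
  proof -
    have fin': "emeasure M {w \<in> S. s \<le> w j - w i} \<noteq> top" for s
      using neq_top_trans[of "emeasure M S"] fin emeasure_mono[of "{w \<in> S. s \<le> w j - w i}" S M] S(1)
      by (auto simp: top_unique)
    have "(\<integral>\<^sup>+w. indicator {w \<in> S. s \<le> w j - w i} w \<partial>M) * (\<integral>\<^sup>+w. indicator {w \<in> S. t \<le> w j - w i} w \<partial>M)
      \<le> (\<integral>\<^sup>+w. indicator {w \<in> S. (s + t) / 2 \<le> w j - w i} w \<partial>M)\<^sup>2"
      unfolding M_def
    proof (rule prekopa_leindler_PiM)
      fix x y
      let ?A = "{w \<in> S. s \<le> w j - w i}" and ?B = "{w \<in> S. t \<le> w j - w i}"
        and ?C = "{w \<in> S. (s + t) / 2 \<le> w j - w i}"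
      show "indicator ?A x * indicator ?B y \<le> (indicator ?C (\<lambda>k\<in>I. (x k + y k) / 2) :: ennreal)\<^sup>2"
      proof (cases "x \<in> ?A \<and> y \<in> ?B")
        case True
        then have "s + t \<le> (x j + y j) - (x i + y i)" by auto
        then have "(\<lambda>k\<in>I. (x k + y k) / 2) \<in> ?C"
          using True midpoint[of x y] I by (simp add: diff_divide_distrib[symmetric])
        then have "indicator ?C (\<lambda>k\<in>I. (x k + y k) / 2) = (1 :: ennreal)"
          by (rule indicator_simps(1))
        then show ?thesis by (simp add: indicator_def)
      next
        case False
        then have "indicator ?A x * indicator ?B y = (0 :: ennreal)"
          by (auto simp: indicator_def)
        then show ?thesis by (simp only: zero_le)
      qed
    qed (rule I borel_measurable_indicator tail_sets[unfolded M_def])+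
    then have "emeasure M {w \<in> S. s \<le> w j - w i} * emeasure M {w \<in> S. t \<le> w j - w i}
        \<le> (emeasure M {w \<in> S. (s + t) / 2 \<le> w j - w i})\<^sup>2"
      by (simp only: nn_integral_indicator tail_sets)
    then show ?thesis
      by (simp only: emeasure_eq_ennreal_measure[OF fin'] ennreal_mult[symmetric] ennreal_power
          measure_nonneg ennreal_le_iff zero_le_power2)
  qed
  have bnd: "\<bar>w j - w i\<bar> \<le> 1" if "w \<in> S" for w
  proof -
    have "w i \<in> {0..1}" "w j \<in> {0..1}" using that S(2) I by (auto simp: PiE_iff)
    then show ?thesis by auto
  qed
  have int: "integrable N (\<lambda>w. w k)" if "k \<in> I" for k
    using that S(2) by (intro N.integrable_const_bound[where B=1] AE_I2) (auto simp: space_N PiE_iff)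
  have Nint: "(\<integral>w. w k \<partial>N) = (LINT w:S|M. w k)" for k
    using S(1) sets.sets_into_space[OF S(1)]
    by (simp add: N_def integral_restrict_space set_lebesgue_integral_def Int_absorb2)
  have tail: "measure M S / 10 \<le> measure M {w \<in> S. 0 \<le> w j - w i}"
  proof -
    have "measure N (space N) / 10 \<le> measure N {w \<in> space N. 0 \<le> w j - w i}"
    proof (rule N.measure_nonneg_ge_of_log_concave_tail)
      show "0 \<le> (\<integral>w. w j - w i \<partial>N)" using mean int I by (simp add: Nint)
    qed (use I bnd log_concave in \<open>simp_all add: space_N meas_N\<close>)
    then show ?thesis by (simp add: space_N meas_N)
  qed
  \<comment> \<open>The two closed halves overlap in the diagonal, which is null and is removed
    before complements are taken.\<close>
  have eq: "{w \<in> S. w j \<le> w i} = S - ({w \<in> S. 0 \<le> w j - w i} - {w \<in> space M. w i = w j})"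
    using sets.sets_into_space[OF S(1)] by auto
  have null: "{w \<in> space M. w i = w j} \<in> null_sets M"
    unfolding M_def using I by (rule null_set_PiM_coordinates_equal)
  have "measure M {w \<in> S. w j \<le> w i}
      = measure M S - measure M ({w \<in> S. 0 \<le> w j - w i} - {w \<in> space M. w i = w j})"
    unfolding eq using fin S(1) tail_sets[of 0] null by (intro measure_Diff) auto
  also have "measure M ({w \<in> S. 0 \<le> w j - w i} - {w \<in> space M. w i = w j})
      = measure M {w \<in> S. 0 \<le> w j - w i}"
    by (rule measure_Diff_null_set[OF tail_sets null])
  finally show ?thesis using tail by simp
qed

section \<open>Order polytopes and exchanges\<close>

lemma order_polytope_subset: "order_polytope d A \<subseteq> {1..d} \<rightarrow>\<^sub>E {0..1}"
  by (auto simp: order_polytope_def)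

lemma order_polytope_antimono: "A \<subseteq> A' \<Longrightarrow> order_polytope d A' \<subseteq> order_polytope d A"
  by (auto simp: order_polytope_def)

lemma order_polytope_sets:
  assumes "A \<subseteq> {1..d} \<times> {1..d}"
  shows "order_polytope d A \<in> sets (lebesgue_d d)"
proof -
  have [measurable]: "(\<lambda>w. w k) \<in> borel_measurable (lebesgue_d d)" if "k \<in> {1..d}" for k
    using that unfolding lebesgue_d_def
    by (rule measurable_component_singleton[where M="\<lambda>_. lborel", simplified])
  have "finite A" using assms by (rule finite_subset) simp
  have cube: "({1..d} \<rightarrow>\<^sub>E {0..1}) \<in> sets (lebesgue_d d)"
    unfolding lebesgue_d_def by (intro sets_PiM_I_finite) auto
  have arc: "{w \<in> space (lebesgue_d d). w (snd p) \<le> w (fst p)} \<in> sets (lebesgue_d d)"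
    if "p \<in> A" for p
  proof -
    have "fst p \<in> {1..d}" "snd p \<in> {1..d}" using that assms by auto
    then show ?thesis by measurable
  qed
  have "{w \<in> space (lebesgue_d d). \<forall>p\<in>A. w (snd p) \<le> w (fst p)} \<in> sets (lebesgue_d d)"
    by (intro sets.sets_Collect_finite_All \<open>finite A\<close> arc)
  moreover have "order_polytope d A
      = ({1..d} \<rightarrow>\<^sub>E {0..1}) \<inter> {w \<in> space (lebesgue_d d). \<forall>p\<in>A. w (snd p) \<le> w (fst p)}"
    by (auto simp: order_polytope_def lebesgue_d_def space_PiM PiE_iff extensional_def)
  ultimately show ?thesis using cube by simp
qed

lemma emeasure_lebesgue_d_PiE:
  assumes "\<And>i. i \<in> {1..d} \<Longrightarrow> l i \<le> u i"
  shows "emeasure (lebesgue_d d) (\<Pi>\<^sub>E i\<in>{1..d}. {l i..u i}) = ennreal (\<Prod>i\<in>{1..d}. u i - l i)"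
proof -
  interpret product_sigma_finite "\<lambda>_::nat. lborel :: real measure" ..
  have "emeasure (lebesgue_d d) (\<Pi>\<^sub>E i\<in>{1..d}. {l i..u i}) = (\<Prod>i\<in>{1..d}. ennreal (u i - l i))"
    unfolding lebesgue_d_def using assms by (subst emeasure_PiM) (auto intro!: prod.cong)
  also have "\<dots> = ennreal (\<Prod>i\<in>{1..d}. u i - l i)"
    using assms by (intro prod_ennreal) auto
  finally show ?thesis .
qed

lemma emeasure_order_polytope_le: "emeasure (lebesgue_d d) (order_polytope d A) \<le> 1"
proof -
  have "emeasure (lebesgue_d d) (order_polytope d A)
      \<le> emeasure (lebesgue_d d) (\<Pi>\<^sub>E i\<in>{1..d}. {0..1})"
    using order_polytope_subset unfolding lebesgue_d_def
    by (intro emeasure_mono sets_PiM_I_finite) auto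
  also have "\<dots> = 1" using emeasure_lebesgue_d_PiE[of d "\<lambda>_. 0" "\<lambda>_. 1"] by simp
  finally show ?thesis .
qed

text \<open>The box in which \<open>w i\<close> ranges over the \<open>r i\<close>-th of \<open>d\<close> equal slices of \<open>[0, 1]\<close>, where \<open>r i\<close> is
  the number of nodes reachable from \<open>i\<close>, is contained in the order polytope.\<close>

lemma measure_order_polytope_ge:
  assumes "A \<subseteq> {1..d} \<times> {1..d}" and "acyclic A" and "d \<ge> 1"
  shows "(1 / real d) ^ d \<le> measure (lebesgue_d d) (order_polytope d A)"
proof -
  \<comment> \<open>Acyclicity keeps \<open>i\<close> out of its own reachable set, so
    \<open>r i \<le> d - 1\<close>, and the slices numbered from 0 fit into the unit interval. Along
    an arc \<open>(i, j)\<close> the count drops by at least one, so the slice of \<open>i\<close>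
    lies above that of \<open>j\<close>, touching it at most in an endpoint.\<close>
  define r where "r i = card {k. (i, k) \<in> A\<^sup>+}" for i
  have reach: "{k. (i, k) \<in> A\<^sup>+} \<subseteq> {1..d} - {i}" for i
    using trancl_subset_Sigma[OF assms(1)] \<open>acyclic A\<close> by (auto simp: acyclic_def)
  then have fin: "finite {k. (i, k) \<in> A\<^sup>+}" for i by (rule finite_subset) simp
  have r_less: "r i + 1 \<le> d" if "i \<in> {1..d}" for i
  proof -
    have "r i \<le> card ({1..d} - {i})" unfolding r_def by (intro card_mono reach) simp
    then have "r i \<le> d - 1" using that by simp
    then show ?thesis using \<open>d \<ge> 1\<close> by linarith
  qed
  have r_arc: "r j + 1 \<le> r i" if "(i, j) \<in> A" for i j
  proof -
    have "insert j {k. (j, k) \<in> A\<^sup>+} \<subseteq> {k. (i, k) \<in> A\<^sup>+}"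
      using that by (auto intro: trancl_into_trancl2)
    then have "card (insert j {k. (j, k) \<in> A\<^sup>+}) \<le> r i"
      unfolding r_def by (intro card_mono fin)
    moreover have "j \<notin> {k. (j, k) \<in> A\<^sup>+}" using reach by auto
    ultimately show ?thesis using fin by (simp add: r_def)
  qed
  let ?box = "\<Pi>\<^sub>E i\<in>{1..d}. {real (r i) / d..(real (r i) + 1) / d}"
  have "?box \<subseteq> order_polytope d A"
  proof
    fix w assume w: "w \<in> ?box"
    have w_bnd: "real (r i) / d \<le> w i" "w i \<le> (real (r i) + 1) / d" if "i \<in> {1..d}" for i
      using PiE_mem[OF w that] by auto
    have "w i \<in> {0..1}" if i: "i \<in> {1..d}" for i
    proof -
      have "real (r i) + 1 \<le> real d" using r_less[OF i] by linarith
      then have "(real (r i) + 1) / d \<le> 1" using \<open>d \<ge> 1\<close> by simp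
      moreover have "0 \<le> real (r i) / d" by simp
      ultimately show ?thesis using w_bnd[OF i] unfolding atLeastAtMost_iff by linarith
    qed
    moreover have "w j \<le> w i" if ij: "(i, j) \<in> A" for i j
    proof -
      have "i \<in> {1..d}" "j \<in> {1..d}" using ij assms(1) by auto
      note bnd = w_bnd(1)[OF this(1)] w_bnd(2)[OF this(2)]
      have "real (r j) + 1 \<le> real (r i)" using r_arc[OF ij] by linarith
      then have "(real (r j) + 1) / d \<le> real (r i) / d" by (intro divide_right_mono) auto
      then show ?thesis using bnd by linarith
    qed
    ultimately show "w \<in> order_polytope d A"
      using w by (auto simp: order_polytope_def PiE_iff)
  qed
  then have "emeasure (lebesgue_d d) ?box \<le> emeasure (lebesgue_d d) (order_polytope d A)"
    by (intro emeasure_mono order_polytope_sets assms)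
  moreover have "emeasure (lebesgue_d d) ?box
      = ennreal (\<Prod>i\<in>{1..d}. (real (r i) + 1) / d - real (r i) / d)"
    by (rule emeasure_lebesgue_d_PiE) (simp add: divide_right_mono)
  moreover have "(\<Prod>i\<in>{1..d}. (real (r i) + 1) / d - real (r i) / d) = (1 / real d) ^ d"
    by (simp add: diff_divide_distrib[symmetric])
  ultimately have "ennreal ((1 / real d) ^ d) \<le> emeasure (lebesgue_d d) (order_polytope d A)"
    by simp
  moreover have "emeasure (lebesgue_d d) (order_polytope d A) \<noteq> top"
    using emeasure_order_polytope_le[of d A] by (auto simp: top_unique)
  ultimately show ?thesis
    by (metis emeasure_eq_ennreal_measure ennreal_le_iff measure_nonneg)
qed

section \<open>Tie-breaking and exchanges\<close>

text \<open>A quarter of the smallest strict gap of the centroid: even if two coordinates move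
  towards each other by this much, they keep their order. The entry 1 keeps the minimum defined when
  all coordinates coincide.\<close>

definition tie_break :: "nat \<Rightarrow> (nat \<times> nat) set \<Rightarrow> real" where
  "tie_break d A = (let c = centroid d (order_polytope d A) in
     Min (insert 1 ((\<lambda>(i, j). (c i - c j) / 4) ` {(i, j) \<in> {1..d} \<times> {1..d}. c j < c i})))"

lemma tie_break_pos: "tie_break d A > 0"
proof -
  have "finite {(i, j) \<in> {1..d} \<times> {1..d}. Q i j}" for Q
    by (rule finite_subset[of _ "{1..d} \<times> {1..d}"]) auto
  then show ?thesis unfolding tie_break_def Let_def by (subst Min_gr_iff) auto
qed

text \<open>The perturbation may resolve ties but cannot reverse a strict gap. An inequality between
  coordinates of the prediction thus descends to a weak one for the centroid, which is what a cut
  requires.\<close>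

lemma predictions_tie_break:
  assumes "v \<in> predictions d (tie_break d A) A"
  shows "inj_on v {1..d}"
    and "\<lbrakk>i \<in> {1..d}; j \<in> {1..d}; v i < v j\<rbrakk>
      \<Longrightarrow> centroid d (order_polytope d A) i \<le> centroid d (order_polytope d A) j"
proof -
  define c where "c = centroid d (order_polytope d A)"
  show "inj_on v {1..d}"
    using assms by (auto simp: predictions_def Let_def split: if_splits)
  assume ij: "i \<in> {1..d}" "j \<in> {1..d}" "v i < v j"
  show "centroid d (order_polytope d A) i \<le> centroid d (order_polytope d A) j"
  proof (rule ccontr)
    assume "\<not> ?thesis"
    then have lt: "c j < c i" by (simp add: c_def)
    then have "v \<noteq> c" using ij by auto
    then have close: "L2_set (\<lambda>i. v i - c i) {1..d} \<le> tie_break d A"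
      using assms by (auto simp: predictions_def Let_def c_def[symmetric] split: if_splits)
    have "finite {(i, j) \<in> {1..d} \<times> {1..d}. c j < c i}"
      by (rule finite_subset[of _ "{1..d} \<times> {1..d}"]) auto
    then have "tie_break d A \<le> (c i - c j) / 4"
      unfolding tie_break_def Let_def c_def[symmetric] using ij lt by (intro Min_le) force+
    moreover have "\<bar>v k - c k\<bar> \<le> tie_break d A" if "k \<in> {1..d}" for k
      using member_le_L2_set[of "{1..d}" k "\<lambda>i. \<bar>v i - c i\<bar>"] that close
      by (auto simp: L2_set_def)
    ultimately have "\<bar>v i - c i\<bar> \<le> (c i - c j) / 4" "\<bar>v j - c j\<bar> \<le> (c i - c j) / 4"
      using ij by force+
    then show False using ij(3) lt by (simp add: abs_if split: if_splits)
  qed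
qed

lemma dotp_exch:
  assumes "i \<in> {1..d}" "j \<in> {1..d}"
  shows "dotp d v (exch d x i j) = dotp d v x - v i + v j"
proof -
  have "dotp d v (exch d x i j)
      = (\<Sum>k\<in>{1..d}. v k * real_of_int (x k) - (if k = i then v k else 0) + (if k = j then v k else 0))"
    unfolding dotp_def exch_def by (intro sum.cong) (auto simp: algebra_simps)
  then show ?thesis
    using assms by (simp add: dotp_def sum.distrib sum_subtractf)
qed

text \<open>Serves two purposes: for the hidden vector it shows that arcs from uncorrupted rounds
  are correct, for the prediction it orients the exchange between the two actions.\<close>

lemma argmaxs_exch:
  assumes "x \<in> argmaxs d v X" "exch d x i j \<in> X" "i \<in> {1..d}" "j \<in> {1..d}"
  shows "v j \<le> v i"
  using assms by (auto simp: argmaxs_def is_arg_max_def dotp_exch dest!: spec[of _ "exch d x i j"])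

text \<open>At a coordinate where \<open>x\<close> and \<open>y\<close> differ, the exchange axiom
  moves both points inside \<open>X\<close> in opposite directions. Optimality of \<open>y\<close>
  gives \<open>v i \<le> v j\<close>, and distinct coordinates make this strict. The move at
  \<open>x\<close> is the one that the algorithm records as an arc, so the arc contradicts the
  prediction.\<close>

lemma M_convex_improving_exchange:
  assumes X: "M_convex d X" and v: "inj_on v {1..d}"
    and y: "y \<in> argmaxs d v X" and x: "x \<in> X" and "x \<noteq> y"
  shows "\<exists>i\<in>{1..d}. \<exists>j\<in>{1..d}. i \<noteq> j \<and> exch d x i j \<in> X \<and> v i < v j"
proof -
  have yX: "y \<in> X" using y by (simp add: argmaxs_def is_arg_max_def)
  have exchange: "\<exists>j\<in>{1..d}. x j < y j \<and> exch d x i j \<in> X \<and> exch d y j i \<in> X"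
    if "x \<in> X" "y \<in> X" "i \<in> {1..d}" "x i > y i" for x y i
    using X that unfolding M_convex_def by blast
  have "x \<in> zvec d" "y \<in> zvec d" using X x yX by (auto simp: M_convex_def)
  then obtain k where k: "k \<in> {1..d}" "x k \<noteq> y k" using \<open>x \<noteq> y\<close> PiE_ext by metis
  have strict: ?thesis if "i \<in> {1..d}" "j \<in> {1..d}" "i \<noteq> j" "exch d x i j \<in> X" "exch d y j i \<in> X" for i j
  proof -
    have "v i \<le> v j" using argmaxs_exch[OF y that(5,2,1)] .
    moreover have "v i \<noteq> v j" using inj_onD[OF v] that by blast
    ultimately show ?thesis using that(1-4) by force
  qed
  show ?thesis
  proof (cases "x k > y k")
    case True
    then obtain j where "j \<in> {1..d}" "x j < y j" "exch d x k j \<in> X" "exch d y j k \<in> X"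
      using exchange[OF x yX k(1)] by blast
    then show ?thesis using strict[OF k(1)] True by fastforce
  next
    case False
    then obtain j where "j \<in> {1..d}" "y j < x j" "exch d y k j \<in> X" "exch d x j k \<in> X"
      using exchange[OF yX x k(1)] k(2) by force
    then show ?thesis using strict[OF _ k(1)] False by fastforce
  qed
qed

section \<open>Counting mistakes and restarts\<close>

lemma measure_order_polytope_pos:
  assumes "A \<subseteq> {1..d} \<times> {1..d}" "acyclic A" "d \<ge> 1"
  shows "0 < measure (lebesgue_d d) (order_polytope d A)"
  by (rule less_le_trans[OF _ measure_order_polytope_ge[OF assms]]) (use assms(3) in simp)

lemma measure_order_polytope_decrease:
  assumes A: "A \<subseteq> A'" "A' \<subseteq> {1..d} \<times> {1..d}" and ij: "(i, j) \<in> A'"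
    and v: "v \<in> predictions d (tie_break d A) A" "v i < v j"
    and d: "d \<ge> 1" and acyc: "acyclic A"
  shows "measure (lebesgue_d d) (order_polytope d A')
    \<le> 9 / 10 * measure (lebesgue_d d) (order_polytope d A)"
proof -
  let ?M = "lebesgue_d d" and ?P = "order_polytope d A"
  have A_sub: "A \<subseteq> {1..d} \<times> {1..d}" using A by auto
  have P: "?P \<in> sets ?M" using A_sub by (rule order_polytope_sets)
  have i: "i \<in> {1..d}" and j: "j \<in> {1..d}" using ij A by auto
  have "i \<noteq> j" using v(2) by auto
  \<comment> \<open>Positive volume permits clearing the denominators in the centroid, turning the
    comparison of its coordinates into one of integrals.\<close>
  have pos: "measure ?M ?P > 0"
    using A_sub acyc d by (rule measure_order_polytope_pos)
  have "centroid d ?P i \<le> centroid d ?P j"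
    using predictions_tie_break(2)[OF v(1) i j v(2)] .
  then have mean: "(LINT w:?P|?M. w i) \<le> (LINT w:?P|?M. w j)"
    using i j pos by (simp add: centroid_def divide_le_cancel)
  have mid: "(\<lambda>k\<in>{1..d}. (x k + y k) / 2) \<in> ?P" if "x \<in> ?P" "y \<in> ?P" for x y
  proof -
    have xy: "0 \<le> x k \<and> x k \<le> 1 \<and> 0 \<le> y k \<and> y k \<le> 1" if "k \<in> {1..d}" for k
      using \<open>x \<in> ?P\<close> \<open>y \<in> ?P\<close> that by (force simp: order_polytope_def PiE_iff)
    have arcs: "x l \<le> x k \<and> y l \<le> y k" if "(k, l) \<in> A" for k l
      using \<open>x \<in> ?P\<close> \<open>y \<in> ?P\<close> that by (auto simp: order_polytope_def)
    have "(\<lambda>k\<in>{1..d}. (x k + y k) / 2) \<in> {1..d} \<rightarrow>\<^sub>E {0..1}"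
    proof (rule PiE_I)
      fix k assume "k \<in> {1..d}"
      then show "(\<lambda>k\<in>{1..d}. (x k + y k) / 2) k \<in> {0..1}" using xy[of k] by simp
    qed (simp only: restrict_def if_False)
    moreover have "(\<lambda>k\<in>{1..d}. (x k + y k) / 2) l \<le> (\<lambda>k\<in>{1..d}. (x k + y k) / 2) k"
      if kl: "(k, l) \<in> A" for k l
    proof -
      have "k \<in> {1..d}" "l \<in> {1..d}" using A_sub kl by auto
      then show ?thesis using arcs[OF kl] by (simp add: add_mono divide_right_mono)
    qed
    ultimately show ?thesis unfolding order_polytope_def by blast
  qed
  have half: "{w \<in> ?P. w j \<le> w i} \<in> sets ?M"
  proof -
    have "{w \<in> ?P. w j \<le> w i} = order_polytope d (insert (i, j) A)"
      by (auto simp: order_polytope_def)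
    then show ?thesis using A_sub i j by (simp add: order_polytope_sets)
  qed
  have "emeasure ?M {w \<in> ?P. w j \<le> w i} \<le> emeasure ?M ?P"
    using P by (intro emeasure_mono) auto
  then have fin: "emeasure ?M {w \<in> ?P. w j \<le> w i} \<noteq> \<infinity>"
    using emeasure_order_polytope_le[of d A] by (auto simp: top_unique)
  have "w j \<le> w i" if "w \<in> order_polytope d A'" for w
    using that ij by (auto simp: order_polytope_def)
  then have "order_polytope d A' \<subseteq> {w \<in> ?P. w j \<le> w i}"
    using order_polytope_antimono[OF A(1), of d] by blast
  then have "measure ?M (order_polytope d A') \<le> measure ?M {w \<in> ?P. w j \<le> w i}"
    using half fin order_polytope_sets[OF A(2)]
    by (intro measure_mono_fmeasurable fmeasurableI) (simp_all add: less_top[symmetric])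
  also have "\<dots> \<le> 9 / 10 * measure ?M ?P"
    using measure_halfspace_le_of_centroid[of "{1..d}" i j ?P] i j \<open>i \<noteq> j\<close> P
      order_polytope_subset mid mean unfolding lebesgue_d_def by auto
  finally show ?thesis .
qed

lemma minus_ln_measure_order_polytope_le:
  assumes "A \<subseteq> {1..d} \<times> {1..d}" "acyclic A" "d \<ge> 1"
  shows "- ln (measure (lebesgue_d d) (order_polytope d A)) \<le> real d * ln (real d)"
proof -
  have "ln ((1 / real d) ^ d) \<le> ln (measure (lebesgue_d d) (order_polytope d A))"
    using assms by (intro ln_mono measure_order_polytope_ge measure_order_polytope_pos) auto
  moreover have "ln ((1 / real d) ^ d) = - (real d * ln (real d))"
    using assms by (simp add: ln_realpow ln_div)
  ultimately show ?thesis by simp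
qed

lemma card_Collect_atLeastAtMost_Suc:
  "card {t \<in> {1..Suc T}. P t} = card {t \<in> {1..T}. P t} + of_bool (P (Suc T))"
proof -
  have "{t \<in> {1..Suc T}. P t} = (if P (Suc T) then insert (Suc T) {t \<in> {1..T}. P t} else {t \<in> {1..T}. P t})"
    by (auto simp: le_Suc_eq)
  then show ?thesis by simp
qed

text \<open>\<open>R\<close> counts the restarts.  The potential is the number of mistakes, measured in units of
  \<open>ln (10 / 9)\<close>, against the logarithmic volume lost since the last restart.\<close>

lemma mistakes_potential:
  fixes d :: nat and w :: "nat \<Rightarrow> real"
  defines "L \<equiv> ln (10 / 9 :: real)" and "D \<equiv> real d * ln (real d)"
    and "W \<equiv> {(i, j). w j < w i}"
  assumes d: "d \<ge> 1" and w: "inj_on w {1..d}"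
    and "\<forall>t\<in>{1..T}. M_convex d (X t)" and "\<forall>t\<in>{1..T}. x t \<in> X t"
    and "alg_run d (tie_break d) T X x A wh xh"
  shows "A (Suc T) \<subseteq> {1..d} \<times> {1..d} \<and> acyclic (A (Suc T)) \<and>
    (\<exists>R::nat. real (card {t \<in> {1..T}. x t \<noteq> xh t}) * L
        \<le> real R * (D + L) - ln (measure (lebesgue_d d) (order_polytope d (A (Suc T)))) \<and>
      R + of_bool (\<not> A (Suc T) \<subseteq> W) \<le> corruptions d T w X x)"
  using assms(6-8)
\<comment> \<open>The indicator in the invariant reserves a corruption that introduced a false arc
  in the current phase. Since \<open>W\<close> is a strict order, a cycle needs an arc outside
  \<open>W\<close>; the restart then spends the reserved corruption, or that of the present round,
  on the increment of \<open>R\<close>.\<close>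
proof (induction T)
  case 0
  have "emeasure (lebesgue_d d) (order_polytope d {}) = 1"
    using emeasure_lebesgue_d_PiE[of d "\<lambda>_. 0" "\<lambda>_. 1"] by (simp add: order_polytope_def)
  then have "measure (lebesgue_d d) (order_polytope d {}) = 1" by (simp add: measure_def)
  moreover have "A 1 = {}" using 0 by (simp add: alg_run_def)
  ultimately show ?case by (auto simp: acyclic_def intro!: exI[of _ 0])
next
  case (Suc T)
  have "alg_run d (tie_break d) T X x A wh xh" using Suc.prems(3) by (auto simp: alg_run_def)
  then have IH: "A (Suc T) \<subseteq> {1..d} \<times> {1..d}" "acyclic (A (Suc T))"
    "\<exists>R::nat. real (card {t \<in> {1..T}. x t \<noteq> xh t}) * L
        \<le> real R * (D + L) - ln (measure (lebesgue_d d) (order_polytope d (A (Suc T)))) \<and>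
      R + of_bool (\<not> A (Suc T) \<subseteq> W) \<le> corruptions d T w X x"
    using Suc.IH Suc.prems(1,2) by auto
  obtain R where R: "real (card {t \<in> {1..T}. x t \<noteq> xh t}) * L
        \<le> real R * (D + L) - ln (measure (lebesgue_d d) (order_polytope d (A (Suc T))))"
      "R + of_bool (\<not> A (Suc T) \<subseteq> W) \<le> corruptions d T w X x"
    using IH(3) by auto
  let ?n = "Suc T"
  let ?V = "\<lambda>A. measure (lebesgue_d d) (order_polytope d A)"
  have X: "M_convex d (X ?n)" "x ?n \<in> X ?n" using Suc.prems(1,2) by auto
  have run: "wh ?n \<in> predictions d (tie_break d (A ?n)) (A ?n)" "xh ?n \<in> argmaxs d (wh ?n) (X ?n)"
      "A (Suc ?n) = next_arcs d (A ?n) (X ?n) (x ?n)"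
    using Suc.prems(3) by (auto simp: alg_run_def)
  define A' where "A' = A ?n \<union> {(i, j). i \<in> {1..d} \<and> j \<in> {1..d} \<and> i \<noteq> j \<and> exch d (x ?n) i j \<in> X ?n}"
  have A': "A ?n \<subseteq> A'" "A' \<subseteq> {1..d} \<times> {1..d}" using IH(1) by (auto simp: A'_def)
  have next_A: "A (Suc ?n) = (if acyclic A' then A' else {})"
    using run(3) by (simp add: next_arcs_def A'_def Let_def)
  have L: "L > 0" by (simp add: L_def)
  have corr: "corruptions d ?n w X x
      = corruptions d T w X x + of_bool (x ?n \<notin> argmaxs d w (X ?n))"
    unfolding corruptions_def by (rule card_Collect_atLeastAtMost_Suc)
  have mist: "real (card {t \<in> {1..?n}. x t \<noteq> xh t}) * L
      = real (card {t \<in> {1..T}. x t \<noteq> xh t}) * L + of_bool (x ?n \<noteq> xh ?n) * L"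
    by (subst card_Collect_atLeastAtMost_Suc) (simp add: algebra_simps)
  have true_arcs: "A' \<subseteq> W" if "A ?n \<subseteq> W" "x ?n \<in> argmaxs d w (X ?n)"
  proof -
    have "w j < w i" if "i \<in> {1..d}" "j \<in> {1..d}" "i \<noteq> j" "exch d (x ?n) i j \<in> X ?n" for i j
    proof -
      have "w j \<le> w i" using argmaxs_exch \<open>x ?n \<in> argmaxs d w (X ?n)\<close> that by blast
      moreover have "w j \<noteq> w i" using inj_onD[OF w] that by metis
      ultimately show ?thesis by simp
    qed
    then show ?thesis using that(1) by (auto simp: A'_def W_def)
  qed
  have acyclic_W: "acyclic B" if "B \<subseteq> W" for B
  proof -
    have "trans W" by (auto simp: W_def trans_def)
    then have "acyclic W" by (auto simp: acyclic_def trancl_id W_def)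
    then show ?thesis using that by (rule acyclic_subset)
  qed
  show ?case
  proof (cases "acyclic A'")
    case True
    then have A_Suc: "A (Suc ?n) = A'" using next_A by simp
    have pos: "0 < ?V A'" "0 < ?V (A ?n)"
      using measure_order_polytope_pos[OF _ _ d] A' True IH by auto
    have "?V A' \<le> exp (- (of_bool (x ?n \<noteq> xh ?n) * L)) * ?V (A ?n)"
    proof (cases "x ?n = xh ?n")
      case True
      have "emeasure (lebesgue_d d) (order_polytope d (A ?n)) \<noteq> \<infinity>"
        using emeasure_order_polytope_le[of d "A ?n"] by (auto simp: top_unique)
      then have "?V A' \<le> ?V (A ?n)"
        using order_polytope_antimono[OF A'(1)] order_polytope_sets A'(2) IH(1)
        by (intro measure_mono_fmeasurable fmeasurableI) (auto simp: less_top[symmetric])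
      then show ?thesis using True by simp
    next
      case False
      obtain i j where "i \<in> {1..d}" "j \<in> {1..d}" "i \<noteq> j" "exch d (x ?n) i j \<in> X ?n" "wh ?n i < wh ?n j"
        using M_convex_improving_exchange[OF X(1) predictions_tie_break(1)[OF run(1)] run(2) X(2) False]
        by auto
      then have "(i, j) \<in> A'" "wh ?n i < wh ?n j" by (auto simp: A'_def)
      then have "?V A' \<le> 9 / 10 * ?V (A ?n)"
        using measure_order_polytope_decrease[OF A' _ run(1) _ d IH(2)] by auto
      moreover have "exp (- L) = 9 / 10" by (simp add: L_def exp_minus)
      ultimately have "?V A' \<le> exp (- L) * ?V (A ?n)" by (simp only:)
      then show ?thesis using False by simp
    qed
    then have "ln (?V A') \<le> ln (exp (- (of_bool (x ?n \<noteq> xh ?n) * L)) * ?V (A ?n))"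
      using pos by (intro ln_mono) auto
    also have "\<dots> = - (of_bool (x ?n \<noteq> xh ?n) * L) + ln (?V (A ?n))"
      using pos by (simp add: ln_mult)
    finally have "real (card {t \<in> {1..?n}. x t \<noteq> xh t}) * L \<le> real R * (D + L) - ln (?V A')"
      using R(1) mist by linarith
    moreover have "R + of_bool (\<not> A' \<subseteq> W) \<le> corruptions d ?n w X x"
      using R(2) corr true_arcs by (auto simp: of_bool_def split: if_splits)
    ultimately show ?thesis using True A'(2) unfolding A_Suc by blast
  next
    case False
    then have A_Suc: "A (Suc ?n) = {}" using next_A by simp
    \<comment> \<open>A restart is charged \<open>D + L\<close>: the phase lost at most
      \<open>D\<close> of logarithmic volume before this round, and a mistake in the round itself
      costs another \<open>L\<close>, because its cut is discarded with the arcs.\<close>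
    have V1: "?V {} \<le> 1"
      using emeasure_order_polytope_le[of d "{}"] by (simp add: measure_def enn2real_leI)
    have "0 < ?V {}" using measure_order_polytope_pos[OF _ _ d] by (auto simp: acyclic_def)
    then have "ln (?V {}) \<le> 0" using V1 by simp
    moreover have "- ln (?V (A ?n)) \<le> D"
      unfolding D_def using IH(1,2) d by (rule minus_ln_measure_order_polytope_le)
    moreover have "of_bool (x ?n \<noteq> xh ?n) * L \<le> L" using L by simp
    moreover have "real (Suc R) * (D + L) = real R * (D + L) + (D + L)" by (simp add: algebra_simps)
    ultimately have "real (card {t \<in> {1..?n}. x t \<noteq> xh t}) * L \<le> real (Suc R) * (D + L) - ln (?V {})"
      using R(1) mist by linarith
    moreover have "Suc R + of_bool (\<not> {} \<subseteq> W) \<le> corruptions d ?n w X x"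
      using R(2) corr true_arcs acyclic_W[of A'] False by (auto simp: of_bool_def split: if_splits)
    moreover have "acyclic ({} :: (nat \<times> nat) set)" by (rule acyclic_W) simp
    ultimately show ?thesis unfolding A_Suc by blast
  qed
qed

section \<open>From mistakes to regret\<close>

lemma mistakes_bound:
  assumes d: "d \<ge> 2" and w: "inj_on w {1..d}"
    and run: "\<forall>t\<in>{1..T}. M_convex d (X t)" "\<forall>t\<in>{1..T}. x t \<in> X t"
      "alg_run d (tie_break d) T X x A wh xh"
  shows "real (card {t \<in> {1..T}. x t \<noteq> xh t})
    \<le> (1 / ln (10 / 9) + 1) * (real (corruptions d T w X x) + 1) * real d * ln (real d)"
proof -
  define L D C where "L = ln (10 / 9 :: real)" and "D = real d * ln (real d)"
    and "C = corruptions d T w X x"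
  have L: "L > 0" by (simp add: L_def)
  have d1: "d \<ge> 1" using d by simp
  obtain R :: nat where A: "A (Suc T) \<subseteq> {1..d} \<times> {1..d}" "acyclic (A (Suc T))"
    and R: "real (card {t \<in> {1..T}. x t \<noteq> xh t}) * L
        \<le> real R * (D + L) - ln (measure (lebesgue_d d) (order_polytope d (A (Suc T))))"
      "R \<le> C"
    using mistakes_potential[OF d1 w run] unfolding L_def D_def C_def by auto
  \<comment> \<open>Here \<open>d \<ge> 2\<close> enters: \<open>D \<ge> 1\<close> lets the additive
    \<open>L\<close> of each phase be absorbed into \<open>L * D\<close>.\<close>
  have "ln 2 \<le> ln (real d)" using d by simp
  then have "1 / 2 \<le> ln (real d)" using ln2_ge_two_thirds by linarith
  then have "2 * (1 / 2) \<le> D" unfolding D_def using d by (intro mult_mono) auto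
  then have D: "D \<ge> 1" by simp
  have "real (card {t \<in> {1..T}. x t \<noteq> xh t}) * L \<le> real R * (D + L) + D"
    using R(1) minus_ln_measure_order_polytope_le[OF A d1] by (simp add: D_def)
  \<comment> \<open>The single \<open>D\<close> belongs to the phase after the last restart; it
    becomes the extra one in \<open>C + 1\<close>.\<close>
  also have "\<dots> \<le> real C * (D + L) + (D + L)"
    using R(2) D L by (intro add_mono mult_right_mono) auto
  also have "\<dots> = (real C + 1) * (D + L)" by (simp add: algebra_simps)
  also have "\<dots> \<le> (real C + 1) * (D + L * D)"
    using D L by (intro mult_left_mono add_left_mono) auto
  also have "\<dots> = ((1 / L + 1) * (real C + 1) * D) * L"
    using L by (simp add: field_simps)
  finally have "real (card {t \<in> {1..T}. x t \<noteq> xh t}) \<le> (1 / L + 1) * (real C + 1) * D"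
    using L by simp
  then show ?thesis by (simp add: L_def D_def C_def mult.assoc)
qed

lemma regret_le_mistakes:
  assumes "B > 0"
    and "\<forall>t\<in>{1..T}. \<forall>y\<in>X t. \<forall>y'\<in>X t. dotp d w (\<lambda>i. y i - y' i) \<le> B"
    and "\<forall>t\<in>{1..T}. x t \<in> X t"
    and "alg_run d \<eta> T X x A wh xh"
  shows "regret d T w x xh \<le> B * real (card {t \<in> {1..T}. x t \<noteq> xh t})"
proof -
  have "dotp d w (\<lambda>i. x t i - xh t i) \<le> B * of_bool (x t \<noteq> xh t)" if "t \<in> {1..T}" for t
  proof -
    have "xh t \<in> X t" using assms(4) that by (auto simp: alg_run_def argmaxs_def is_arg_max_def)
    then show ?thesis using assms(2,3) that by (auto simp: dotp_def)
  qed
  then have "regret d T w x xh \<le> (\<Sum>t=1..T. B * of_bool (x t \<noteq> xh t))"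
    unfolding regret_def by (rule sum_mono)
  also have "\<dots> = B * real (card {t \<in> {1..T}. x t \<noteq> xh t})"
    by (simp add: sum_distrib_left[symmetric] Int_def)
  finally show ?thesis .
qed

text \<open>An exchange needs a second coordinate where the inequality is reversed. This case is
  separate because \<open>ln 1 = 0\<close> makes the bound zero, so no mistake at all can be
  afforded.\<close>

lemma M_convex_dimension_1_unique:
  assumes "M_convex 1 X" "x \<in> X" "y \<in> X"
  shows "x = y"
proof (rule ccontr)
  assume "x \<noteq> y"
  moreover have "x \<in> zvec 1" "y \<in> zvec 1" using assms by (auto simp: M_convex_def)
  ultimately have "x 1 \<noteq> y 1" using PiE_ext by fastforce
  then consider "x 1 > y 1" | "y 1 > x 1" by linarith
  then show False
    using assms unfolding M_convex_def by cases force+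
qed

theorem theorem5p3:
  fixes B :: real
  assumes "B > 0"
  shows "\<exists>K::real. K > 0 \<and>
    (\<forall>d::nat. d \<ge> 1 \<longrightarrow>
      (\<exists>\<eta> :: (nat \<times> nat) set \<Rightarrow> real.
        (\<forall>A. A \<subseteq> {1..d} \<times> {1..d} \<and> acyclic A \<longrightarrow> \<eta> A > 0) \<and>
        (\<forall>(T::nat) w X x A wh xh.
           T \<ge> 1 \<longrightarrow>
           w \<in> rvec d \<longrightarrow>
           inj_on w {1..d} \<longrightarrow>
           (\<forall>t\<in>{1..T}. M_convex d (X t)) \<longrightarrow>
           (\<forall>t\<in>{1..T}. \<forall>y\<in>X t. \<forall>y'\<in>X t. dotp d w (\<lambda>i. y i - y' i) \<le> B) \<longrightarrow>
           (\<forall>t\<in>{1..T}. x t \<in> X t) \<longrightarrow>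
           alg_run d \<eta> T X x A wh xh \<longrightarrow>
           regret d T w x xh
             \<le> K * (real (corruptions d T w X x) + 1) * real d * ln (real d))))"
proof -
  \<comment> \<open>Each mistake costs at most \<open>B\<close>. The summand
    \<open>1 / ln (10 / 9)\<close> converts logarithmic volume into mistakes; the summand 1 covers
    the mistake whose cut a restart discards.\<close>
  define K where "K = B * (1 / ln (10 / 9) + 1)"
  have "K > 0" unfolding K_def using \<open>B > 0\<close> by (intro mult_pos_pos add_pos_pos) auto
  moreover have "regret d T w x xh \<le> K * (real (corruptions d T w X x) + 1) * real d * ln (real d)"
    if "d \<ge> 1" and w: "inj_on w {1..d}" and X: "\<forall>t\<in>{1..T}. M_convex d (X t)"
      and bound: "\<forall>t\<in>{1..T}. \<forall>y\<in>X t. \<forall>y'\<in>X t. dotp d w (\<lambda>i. y i - y' i) \<le> B"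
      and x: "\<forall>t\<in>{1..T}. x t \<in> X t" and run: "alg_run d (tie_break d) T X x A wh xh"
    for d T w X x A wh xh
  proof -
    have regret: "regret d T w x xh \<le> B * real (card {t \<in> {1..T}. x t \<noteq> xh t})"
      by (rule regret_le_mistakes[OF \<open>B > 0\<close> bound x run])
    show ?thesis
    proof (cases "d = 1")
      case True
      have "x t = xh t" if "t \<in> {1..T}" for t
      proof (rule M_convex_dimension_1_unique)
        show "xh t \<in> X t" using run that by (auto simp: alg_run_def argmaxs_def is_arg_max_def)
      qed (use X x that True in auto)
      then have no_mistake: "{t \<in> {1..T}. x t \<noteq> xh t} = {}" by auto
      show ?thesis using regret True unfolding no_mistake by simp
    next
      case False
      then have "d \<ge> 2" using \<open>d \<ge> 1\<close> by simp
      then have "B * real (card {t \<in> {1..T}. x t \<noteq> xh t})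
          \<le> B * ((1 / ln (10 / 9) + 1) * (real (corruptions d T w X x) + 1) * real d * ln (real d))"
        using \<open>B > 0\<close> w X x run by (intro mult_left_mono mistakes_bound) auto
      then show ?thesis using regret unfolding K_def by (simp only: mult.assoc)
    qed
  qed
  ultimately show ?thesis
    using tie_break_pos by (intro exI[of _ K] conjI allI impI exI[of _ "tie_break _"]) blast+
qed

end
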